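(* Let $K$ be a local field with finite residue field of characteristic $p$ and cardinality $q$, let $e>0$ be an integer with $e\not\equiv 0\pmod p$, and let $f>0$ be an integer. Let $K_f$ be the unramified extension of $K$ of degree $f$ and $G_f=\mathrm{Gal}(K_f|K)$. Let $L=K_f(\sqrt[e]{D})$ be a totally ramified extension of $K_f$ of degree $e$, where $D\subset K_f^\times/K_f^{\times e}$ is the corresponding ramified line. Then $L$ is galoisian (i.e. Galois) over $K$ if and only if the $G_f$-orbit of $D$ consists of the single element $D$ and $q^f\equiv 1\pmod e$.
   Context: A local field is a field complete for a discrete valuation with finite residue field. Let $w_f:K_f^\times\to\mathbf Z$ be the normalised valuation of $K_f$, and $\bar w_f:K_f^\times/K_f^{\times e}\to\mathbf Z/e\mathbf Z$ the induced map. A ramified line in $K_f^\times/K_f^{\times e}$ is a subgroup $D$ such that the restriction of $\bar w_f$ to $D$ is an isomorphism $D\to\mathbf Z/e\mathbf Z$. Every ramified line $D$ is generated by the image of a uniformiser $\varpi$ of $K_f$, and the image of $\varpi$ (the element of $D$ mapping to $1\in\mathbf Z/e\mathbf Z$) is unique; $K_f(\sqrt[e]{D})$ denotes the extension $K_f[T]/(T^e-\varpi)$, which is totally ramified of degree $e$ over $K_f$ and independent of the choice of $\varpi$ up to $K_f$-isomorphism. The map $D\mapsto K_f(\sqrt[e]{D})$ is a bijection from the set of ramified lines to the set of $K_f$-isomorphism classes of totally ramified extensions of $K_f$ of degree $e$. $G_f$ acts on ramified lines through its natural action on $K_f^\times/K_f^{\times e}$. *)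

theory Defs
  imports
    "HOL-Algebra.Multiplicative_Group"
    "HOL-Algebra.Elementary_Groups"
    "HOL-Algebra.QuotRing"
    "HOL-Algebra.Group_Action"
    "HOL-Number_Theory.Cong"
    "HOL-Algebra.Algebraic_Closure_Type"
begin

text \<open>
  Fields are types of class \<open>field\<close>, and a field extension is given by its structural embedding.
  Groups and quotients attached to them are formed in HOL-Algebra, through the record
  \<open>ring_of_type_algebra\<close> of a type.
\<close>

abbreviation rng :: "'a::comm_ring_1 ring"
  where "rng \<equiv> ring_of_type_algebra"


section \<open>Local fields\<close>

text \<open>
  The value at \<open>0\<close> is irrelevant; \<open>0\<close> is treated separately wherever it matters.  Surjectivity
  says that the valuation is normalised.
\<close>

definition discrete_valuation :: "('a::field \<Rightarrow> int) \<Rightarrow> bool"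
  where "discrete_valuation v \<longleftrightarrow>
    (\<forall>x y. x \<noteq> 0 \<longrightarrow> y \<noteq> 0 \<longrightarrow> v (x * y) = v x + v y) \<and>
    (\<forall>x y. x \<noteq> 0 \<longrightarrow> y \<noteq> 0 \<longrightarrow> x + y \<noteq> 0 \<longrightarrow> min (v x) (v y) \<le> v (x + y)) \<and>
    v ` (UNIV - {0}) = UNIV"

definition val_ge :: "('a::field \<Rightarrow> int) \<Rightarrow> int \<Rightarrow> 'a \<Rightarrow> bool"
  where "val_ge v N x \<longleftrightarrow> x = 0 \<or> N \<le> v x"

definition complete_valuation :: "('a::field \<Rightarrow> int) \<Rightarrow> bool"
  where "complete_valuation v \<longleftrightarrow>
    (\<forall>s :: nat \<Rightarrow> 'a.
      (\<forall>N. \<exists>M. \<forall>m\<ge>M. \<forall>n\<ge>M. val_ge v N (s m - s n)) \<longrightarrow>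
      (\<exists>l. \<forall>N. \<exists>M. \<forall>n\<ge>M. val_ge v N (s n - l)))"

definition valuation_ring :: "('a::field \<Rightarrow> int) \<Rightarrow> 'a ring"
  where "valuation_ring v = rng\<lparr>carrier := {x. val_ge v 0 x}\<rparr>"

definition residue_field :: "('a::field \<Rightarrow> int) \<Rightarrow> 'a set ring"
  where "residue_field v = valuation_ring v Quot {x. val_ge v 1 x}"

text \<open>The additive order of \<open>1\<close>; \<open>ord\<close> is \<open>0\<close> on elements of infinite order.\<close>

definition ring_char :: "('a, 'b) ring_scheme \<Rightarrow> nat"
  where "ring_char R = group.ord (add_monoid R) \<one>\<^bsub>R\<^esub>"

definition local_field :: "('a::field \<Rightarrow> int) \<Rightarrow> bool"
  where "local_field v \<longleftrightarrow>
    discrete_valuation v \<and> complete_valuation v \<and> finite (carrier (residue_field v))"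


section \<open>Extensions of fields\<close>

definition field_embedding :: "('a::field \<Rightarrow> 'b::field) \<Rightarrow> bool"
  where "field_embedding i \<longleftrightarrow> i \<in> ring_hom rng rng"

text \<open>This is \<open>0\<close> for extensions of infinite degree.\<close>

definition ext_degree :: "('a::field \<Rightarrow> 'b::field) \<Rightarrow> nat"
  where "ext_degree i = vector_space.dim (\<lambda>c x. i c * x) UNIV"

definition galois_group :: "('a::field \<Rightarrow> 'b::field) \<Rightarrow> ('b \<Rightarrow> 'b) monoid"
  where "galois_group i =
    \<lparr>carrier = {\<sigma>. \<sigma> \<in> ring_iso rng rng \<and> (\<forall>a. \<sigma> (i a) = i a)},
     monoid.mult = (\<circ>), one = id\<rparr>"

definition algebraic_extension :: "('a::field \<Rightarrow> 'b::field) \<Rightarrow> bool"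
  where "algebraic_extension i \<longleftrightarrow>
    field_embedding i \<and> (\<forall>x. \<exists>p. p \<noteq> 0 \<and> poly (map_poly i p) x = 0)"

text \<open>Infinite extensions are allowed: algebraic, with the base as fixed field of the automorphisms.\<close>

definition galois_extension :: "('a::field \<Rightarrow> 'b::field) \<Rightarrow> bool"
  where "galois_extension i \<longleftrightarrow>
    algebraic_extension i \<and> {x. \<forall>\<sigma>\<in>carrier (galois_group i). \<sigma> x = x} = range i"

text \<open>
  The normalised valuation \<open>w\<close> of the extension restricts to the normalised valuation \<open>v\<close> of the
  base, i.e. the ramification index is \<open>1\<close>.  Separability of the residue extension is
  automatic over a finite residue field.  If \<open>v\<close> is complete, then \<open>w\<close> is determined by \<open>v\<close> and
  \<open>i\<close>.
\<close>

definition unramified_extension ::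
    "('a::field \<Rightarrow> int) \<Rightarrow> ('b::field \<Rightarrow> int) \<Rightarrow> ('a \<Rightarrow> 'b) \<Rightarrow> nat \<Rightarrow> bool"
  where "unramified_extension v w i f \<longleftrightarrow>
    field_embedding i \<and> 0 < ext_degree i \<and> ext_degree i = f \<and>
    discrete_valuation w \<and> (\<forall>x. x \<noteq> 0 \<longrightarrow> w (i x) = v x)"


section \<open>Ramified lines\<close>

definition eth_powers :: "nat \<Rightarrow> 'a::field set"
  where "eth_powers e = {x ^ e | x. x \<noteq> 0}"

definition power_classes :: "nat \<Rightarrow> 'a::field set monoid"
  where "power_classes e = Multiplicative_Group.mult_of rng Mod eth_powers e"

text \<open>The map induced by \<open>w\<close> on cosets of the \<open>e\<close>-th powers; \<open>w mod e\<close> is constant on each coset.\<close>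

definition val_class :: "nat \<Rightarrow> ('a::field \<Rightarrow> int) \<Rightarrow> 'a set \<Rightarrow> int"
  where "val_class e w C = the_elem ((\<lambda>x. w x mod int e) ` C)"

definition ramified_line :: "nat \<Rightarrow> ('a::field \<Rightarrow> int) \<Rightarrow> 'a set set \<Rightarrow> bool"
  where "ramified_line e w D \<longleftrightarrow>
    subgroup D (power_classes e) \<and>
    val_class e w \<in> iso ((power_classes e)\<lparr>carrier := D\<rparr>) (integer_mod_group e)"

definition line_action :: "('a::field \<Rightarrow> 'a) \<Rightarrow> 'a set set \<Rightarrow> 'a set set"
  where "line_action \<sigma> D = (\<lambda>C. \<sigma> ` C) ` D"

definition radical_quotient_ideal :: "nat \<Rightarrow> 'a::field \<Rightarrow> 'a poly set"
  where "radical_quotient_ideal e a = PIdl\<^bsub>rng\<^esub> (Polynomial.monom 1 e - [:a:])"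

text \<open>
  The extension \<open>j\<close> is isomorphic, over the base field, to \<open>F[T]/(T\<^sup>e - \<pi>)\<close> for a uniformiser
  \<open>\<pi>\<close> whose class lies in \<open>D\<close>.
\<close>

definition radical_extension ::
    "nat \<Rightarrow> ('a::field \<Rightarrow> int) \<Rightarrow> 'a set set \<Rightarrow> ('a \<Rightarrow> 'b::field) \<Rightarrow> bool"
  where "radical_extension e w D j \<longleftrightarrow>
    (\<exists>\<pi>. \<pi> \<noteq> 0 \<and> w \<pi> = 1 \<and> eth_powers e #>\<^bsub>Multiplicative_Group.mult_of rng\<^esub> \<pi> \<in> D \<and>
      (\<exists>\<psi> \<in> ring_iso (rng Quot radical_quotient_ideal e \<pi>) rng.
        \<forall>a. \<psi> (radical_quotient_ideal e \<pi> +>\<^bsub>rng\<^esub> [:a:]) = j a))"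

end

theory Submission
  imports Defs
begin

text \<open>
  Write \<open>L = K\<^sub>f(\<theta>)\<close> with \<open>\<theta>\<^sup>e = \<pi>\<close> a uniformiser.  If \<open>L\<close> is Galois over \<open>K\<close>, the product of
  \<open>T - y\<close> over the conjugates \<open>y\<close> of \<open>\<theta>\<close> has coefficients in \<open>K\<close> and splits with distinct roots.
  It is divisible by \<open>T\<^sup>e - \<pi>\<close>, hence by \<open>T\<^sup>e - \<sigma> \<pi>\<close> for each \<open>\<sigma>\<close> in \<open>G\<^sub>f\<close>.  So \<open>L\<close> contains
  \<open>e\<close> roots of unity of order dividing \<open>e\<close> and an \<open>e\<close>-th root of each \<open>\<sigma> \<pi>\<close>.  Every nonzero
  element of \<open>L\<close> is \<open>c \<theta>\<^sup>k u\<close> with \<open>c\<close> in \<open>K\<^sub>f\<close> and \<open>u\<close> a one-unit; applied to these roots this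
  gives, by Hensel's lemma, that \<open>\<sigma> \<pi>\<close> is a power of \<open>\<pi>\<close> times an \<open>e\<close>-th power, and that \<open>e\<close>
  divides \<open>N = q\<^sup>f - 1\<close>.

  Conversely, if \<open>e\<close> divides \<open>N\<close>, then \<open>K\<^sub>f\<close>, which is generated over \<open>K\<close> by a root of unity
  of order \<open>N\<close>, contains \<open>e\<close> roots of \<open>T\<^sup>e - 1\<close>, and if \<open>\<sigma> \<pi> = z\<^sup>e \<pi>\<close>, then \<open>\<sigma>\<close> extends to \<open>L\<close>
  by \<open>\<theta> \<mapsto> z \<theta>\<close>.  So \<open>K\<close> is the fixed field.
\<close>

section \<open>Field homomorphisms and simple extensions\<close>

locale field_hom =
  fixes i :: "'a::field \<Rightarrow> 'b::field"
  assumes hom_one [simp]: "i 1 = 1"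
    and hom_add: "i (x + y) = i x + i y"
    and hom_mult: "i (x * y) = i x * i y"
begin

lemma hom_zero [simp]: "i 0 = 0"
proof (rule add_left_imp_eq)
  show "i 0 + i 0 = i 0 + 0" by (simp flip: hom_add)
qed

lemma hom_uminus: "i (- x) = - i x"
  using hom_add[of x "- x"] by (simp add: eq_neg_iff_add_eq_0 add.commute)

lemma hom_diff: "i (x - y) = i x - i y"
  using hom_add[of x "- y"] by (simp add: hom_uminus)

lemma hom_eq_0_iff [simp]: "i x = 0 \<longleftrightarrow> x = 0"
proof
  assume "i x = 0"
  show "x = 0"
  proof (rule ccontr)
    assume "x \<noteq> 0"
    then have "i x * i (inverse x) = 1"
      by (simp flip: hom_mult)
    then show False using \<open>i x = 0\<close> by simp
  qed
qed simp

lemma hom_eq_iff [simp]: "i x = i y \<longleftrightarrow> x = y"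
  using hom_eq_0_iff[of "x - y"] by (simp add: hom_diff)

lemma hom_inj: "inj i"
  by (simp add: inj_def)

lemma hom_power: "i (x ^ n) = i x ^ n"
  by (induction n) (simp_all add: hom_mult)

lemma hom_sum: "i (sum h A) = (\<Sum>x\<in>A. i (h x))"
  by (induction A rule: infinite_finite_induct) (simp_all add: hom_add)

lemma hom_inverse: "i (inverse x) = inverse (i x)"
proof (cases "x = 0")
  case False
  then have "i x * i (inverse x) = 1"
    by (simp flip: hom_mult)
  then show ?thesis by (rule inverse_unique[symmetric])
qed simp

lemma hom_divide: "i (x / y) = i x / i y"
  by (simp add: divide_inverse hom_mult hom_inverse)

lemma hom_of_nat [simp]: "i (of_nat n) = of_nat n"
  by (induction n) (simp_all add: hom_add)

lemma coeff_map [simp]: "coeff (map_poly i p) n = i (coeff p n)"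
  by (simp add: coeff_map_poly)

lemma map_poly_eq_0 [simp]: "map_poly i p = 0 \<longleftrightarrow> p = 0"
  by (simp add: map_poly_eq_0_iff)

lemma degree_map [simp]: "degree (map_poly i p) = degree p"
  by (simp add: degree_map_poly)

lemma map_poly_add: "map_poly i (p + q) = map_poly i p + map_poly i q"
  by (simp add: poly_eq_iff hom_add)

lemma map_poly_diff: "map_poly i (p - q) = map_poly i p - map_poly i q"
  by (simp add: poly_eq_iff hom_diff)

lemma map_poly_mult: "map_poly i (p * q) = map_poly i p * map_poly i q"
  by (simp add: poly_eq_iff coeff_mult hom_sum hom_mult)

lemma map_poly_const: "map_poly i [:a:] = [:i a:]"
  by (simp add: map_poly_pCons)

lemma hom_poly: "i (poly p x) = poly (map_poly i p) (i x)"
  by (induction p) (simp_all add: map_poly_pCons hom_add hom_mult)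

lemma map_poly_dvd: "p dvd q \<Longrightarrow> map_poly i p dvd map_poly i q"
  by (auto simp: map_poly_mult)

lemma map_poly_radical:
  "map_poly i (Polynomial.monom 1 n - [:a:]) = Polynomial.monom 1 n - [:i a:]"
  by (simp add: map_poly_diff map_poly_const map_poly_monom)

end

lemma field_hom_compose:
  "field_hom i \<Longrightarrow> field_hom j \<Longrightarrow> field_hom (j \<circ> i)"
  by (simp add: field_hom_def)

lemma field_hom_id: "field_hom id"
  by (simp add: field_hom_def)

lemma field_hom_map_comp:
  assumes "field_hom i" "field_hom j"
  shows "map_poly j (map_poly i p) = map_poly (j \<circ> i) p"
  using assms by (simp add: map_poly_map_poly field_hom.hom_zero)

lemma field_embedding_iff: "field_embedding i \<longleftrightarrow> field_hom i"
  by (auto simp: field_embedding_def ring_hom_def ring_of_type_algebra_def field_hom_def)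

text \<open>Field homomorphisms are injective, so of bijectivity only surjectivity remains to be
  recorded.\<close>

lemma galois_group_carrier:
  "\<sigma> \<in> carrier (galois_group i) \<longleftrightarrow> field_hom \<sigma> \<and> surj \<sigma> \<and> (\<forall>a. \<sigma> (i a) = i a)"
proof -
  have "\<sigma> \<in> ring_iso rng rng \<longleftrightarrow> field_hom \<sigma> \<and> bij \<sigma>"
    unfolding ring_iso_def by (auto simp: ring_hom_def ring_of_type_algebra_def field_hom_def)
  then show ?thesis
    by (auto simp: galois_group_def bij_def field_hom.hom_inj)
qed

section \<open>Radical polynomials and root counts\<close>

lemma poly_radical [simp]:
  fixes x :: "'a::field"
  shows "poly (Polynomial.monom 1 n - [:a:]) x = x ^ n - a"
  by (simp add: poly_monom)

lemma degree_radical: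
  fixes a :: "'a::field"
  assumes "n > 0"
  shows "degree (Polynomial.monom 1 n - [:a:]) = n"
proof -
  have "degree (Polynomial.monom (1::'a) n + - [:a:]) = degree (Polynomial.monom (1::'a) n)"
    by (rule degree_add_eq_left) (use assms in \<open>simp add: degree_monom_eq\<close>)
  then show ?thesis
    unfolding diff_conv_add_uminus by (simp only: degree_monom_eq one_neq_zero not_False_eq_True)
qed

lemma radical_neq_0:
  fixes a :: "'a::field"
  assumes "n > 0"
  shows "Polynomial.monom 1 n - [:a:] \<noteq> 0"
  using degree_radical[OF assms, of a] assms by auto

lemma card_roots_of_unity_le:
  assumes "n > 0"
  shows "finite {x::'a::field. x ^ n = 1}" "card {x::'a::field. x ^ n = 1} \<le> n"
  using poly_roots_finite[OF radical_neq_0[OF assms, of "1::'a"]]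
    card_poly_roots_bound[OF radical_neq_0[OF assms, of "1::'a"]]
  by (simp_all add: degree_radical[OF assms] poly_monom)

text \<open>With \<open>q = p * r\<close>, the factor \<open>r\<close> contributes at most
  \<open>degree r\<close> roots, so a shortage of roots of \<open>p\<close> could not be made up. A
  root count equal to the degree serves throughout as the form of splitting with distinct
  roots.\<close>

lemma card_roots_dvd:
  fixes p q :: "'a::field poly"
  assumes "q \<noteq> 0" "p dvd q" "card {x. poly q x = 0} = degree q"
  shows "card {x. poly p x = 0} = degree p"
proof -
  obtain r where r: "q = p * r" using assms by blast
  have nz: "p \<noteq> 0" "r \<noteq> 0" using assms r by auto
  have "{x. poly q x = 0} = {x. poly p x = 0} \<union> {x. poly r x = 0}"
    using r by auto
  then have "degree q \<le> card {x. poly p x = 0} + card {x. poly r x = 0}"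
    using card_Un_le assms(3) by metis
  moreover have "degree q = degree p + degree r"
    using nz r degree_mult_eq by blast
  moreover have "card {x. poly r x = 0} \<le> degree r" "card {x. poly p x = 0} \<le> degree p"
    using nz card_poly_roots_bound by blast+
  ultimately show ?thesis by linarith
qed

text \<open>A polynomial over the base that kills \<open>x\<close> has finitely many roots. The map
  sends this root set injectively into itself, hence onto itself, and \<open>x\<close> is one of its
  members.\<close>

lemma algebraic_endomorphism_surj:
  assumes i: "field_hom i" and s: "field_hom \<sigma>"
    and alg: "\<And>x. \<exists>p. p \<noteq> 0 \<and> poly (map_poly i p) x = 0"
    and fix_base: "\<And>a. \<sigma> (i a) = i a"
  shows "surj \<sigma>"
  unfolding surj_def
proof
  fix x
  obtain p where p: "p \<noteq> 0" "poly (map_poly i p) x = 0" using alg by blast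
  let ?S = "{y. poly (map_poly i p) y = 0}"
  have "map_poly \<sigma> (map_poly i p) = map_poly i p"
    using field_hom_map_comp[OF i s] fix_base by (simp add: comp_def)
  then have "poly (map_poly i p) (\<sigma> y) = 0" if "poly (map_poly i p) y = 0" for y
    using that field_hom.hom_poly[OF s, of "map_poly i p"] field_hom.hom_zero[OF s] by metis
  then have "\<sigma> ` ?S \<subseteq> ?S" by auto
  moreover have "finite ?S"
    using p i poly_roots_finite field_hom.map_poly_eq_0 by blast
  ultimately have "\<sigma> ` ?S = ?S"
    by (intro endo_inj_surj inj_on_subset[OF field_hom.hom_inj[OF s]]) auto
  then show "\<exists>y. x = \<sigma> y" using p by blast
qed

text \<open>Presents the extension as the polynomial ring modulo \<open>g\<close>, with \<theta> the
  image of the variable. Both layers have this form: \<open>g\<close> is a minimal polynomial of a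
  root of unity for K_f over K, and T^e - \<pi> for L over K_f.\<close>

locale simple_ext = field_hom i for i :: "'a::field \<Rightarrow> 'b::field" +
  fixes \<theta> :: 'b and g :: "'a poly"
  assumes generated: "\<exists>h. x = poly (map_poly i h) \<theta>"
    and kernel: "poly (map_poly i h) \<theta> = 0 \<longleftrightarrow> g dvd h"
    and g_neq_0: "g \<noteq> 0"
begin

lemma g_root: "poly (map_poly i g) \<theta> = 0"
  by (simp add: kernel)

lemma degree_g_pos: "degree g > 0"
proof (rule ccontr)
  assume "\<not> degree g > 0"
  then have "g dvd 1"
    using g_neq_0 is_unit_iff_degree by blast
  then show False using kernel[of 1] by simp
qed

lemma generated_reduced: "\<exists>h. x = poly (map_poly i h) \<theta> \<and> degree h < degree g"
proof -
  obtain h where h: "x = poly (map_poly i h) \<theta>" using generated by blast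
  have "poly (map_poly i (h - h mod g)) \<theta> = 0"
    unfolding kernel by (simp add: minus_mod_eq_mult_div)
  then have "x = poly (map_poly i (h mod g)) \<theta>"
    using h by (simp add: map_poly_diff)
  moreover have "degree (h mod g) < degree g"
    using degree_mod_less'[OF g_neq_0] degree_g_pos 
    by (cases "h mod g = 0") simp_all
  ultimately show ?thesis by blast
qed

text \<open>Two polynomials with the same value at \<theta> differ by a multiple of
  \<open>g\<close>, which dies at \<theta>' once \<tau> is applied to its coefficients; so the
  choice of representative is harmless. A general \<tau> on the base is allowed because
  automorphisms of K_f have to be lifted to L.\<close>

lemma extend_hom:
  fixes \<tau> :: "'a \<Rightarrow> 'c::field"
  assumes "field_hom \<tau>" and root: "poly (map_poly \<tau> g) \<theta>' = 0"
  shows "\<exists>\<sigma>. field_hom \<sigma> \<and> (\<forall>a. \<sigma> (i a) = \<tau> a) \<and> \<sigma> \<theta> = \<theta>' \<and>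
    (\<forall>h. \<sigma> (poly (map_poly i h) \<theta>) = poly (map_poly \<tau> h) \<theta>')"
proof -
  interpret t: field_hom \<tau> by fact
  define \<sigma> where "\<sigma> x = poly (map_poly \<tau> (SOME h. x = poly (map_poly i h) \<theta>)) \<theta>'" for x
  have \<sigma>: "\<sigma> (poly (map_poly i h) \<theta>) = poly (map_poly \<tau> h) \<theta>'" for h
  proof -
    let ?k = "SOME k. poly (map_poly i h) \<theta> = poly (map_poly i k) \<theta>"
    have "poly (map_poly i h) \<theta> = poly (map_poly i ?k) \<theta>"
      by (rule someI[of _ h]) simp
    then have "poly (map_poly i (h - ?k)) \<theta> = 0"
      by (simp add: map_poly_diff)
    then obtain r where "h - ?k = g * r" using kernel by blast
    then have "poly (map_poly \<tau> (h - ?k)) \<theta>' = 0"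
      by (simp add: t.map_poly_mult root)
    then show ?thesis by (simp add: \<sigma>_def t.map_poly_diff)
  qed
  have base: "\<sigma> (i a) = \<tau> a" for a
    using \<sigma>[of "[:a:]"] by (simp add: map_poly_const t.map_poly_const)
  have "field_hom \<sigma>"
  proof
    show "\<sigma> 1 = 1" using base[of 1] by simp
  next
    fix x y
    obtain h k where "x = poly (map_poly i h) \<theta>" "y = poly (map_poly i k) \<theta>"
      using generated by meson
    then show "\<sigma> (x + y) = \<sigma> x + \<sigma> y" "\<sigma> (x * y) = \<sigma> x * \<sigma> y"
      using \<sigma>[of "h + k"] \<sigma>[of "h * k"] \<sigma>
      by (simp_all add: map_poly_add map_poly_mult t.map_poly_add t.map_poly_mult)
  qed
  moreover have "\<sigma> \<theta> = \<theta>'"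
    using \<sigma>[of "[:0, 1:]"] by (simp add: map_poly_pCons)
  ultimately show ?thesis using \<sigma> base by blast
qed

text \<open>Write x = h(\<theta>) with deg h < deg g. Sending \<theta> to any root y of
  \<open>g\<close> fixes x, so h(y) = x. Thus h - x has deg g roots, more than its degree permits;
  it vanishes, and x is the constant term of h.\<close>

lemma fixed_by_conjugations:
  assumes split: "card {y. poly (map_poly i g) y = 0} = degree g"
    and fixed: "\<And>\<sigma>. field_hom \<sigma> \<Longrightarrow> (\<And>a. \<sigma> (i a) = i a) \<Longrightarrow> \<sigma> x = x"
  shows "x \<in> range i"
proof -
  obtain h where h: "x = poly (map_poly i h) \<theta>" "degree h < degree g"
    using generated_reduced by blast
  let ?P = "map_poly i h - [:x:]"
  have roots: "{y. poly (map_poly i g) y = 0} \<subseteq> {y. poly ?P y = 0}"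
  proof safe
    fix y assume "poly (map_poly i g) y = 0"
    then obtain \<sigma> where \<sigma>: "field_hom \<sigma>" "\<And>a. \<sigma> (i a) = i a"
        "\<And>h. \<sigma> (poly (map_poly i h) \<theta>) = poly (map_poly i h) y"
      using extend_hom[OF field_hom_axioms] by metis
    then show "poly ?P y = 0" using fixed[of \<sigma>] h by simp
  qed
  have deg: "degree ?P < degree g"
    by (rule degree_diff_less) (use h degree_g_pos in auto)
  have "?P = 0"
  proof (rule ccontr)
    assume nz: "?P \<noteq> 0"
    have "card {y. poly (map_poly i g) y = 0} \<le> card {y. poly ?P y = 0}"
      by (rule card_mono[OF poly_roots_finite[OF nz] roots])
    then show False
      using split deg card_poly_roots_bound[OF nz] by linarith
  qed
  then have "coeff ?P 0 = 0" by simp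
  then have "x = i (coeff h 0)" by simp
  then show ?thesis by blast
qed

end

section \<open>Discretely valued fields\<close>

locale valued_field =
  fixes w :: "'a::field \<Rightarrow> int"
  assumes discrete: "discrete_valuation w"
begin

abbreviation cong_m :: "'a \<Rightarrow> 'a \<Rightarrow> bool" (infix \<open>\<approx>\<close> 50)
  where "x \<approx> y \<equiv> val_ge w 1 (x - y)"

lemma val_mult: "x \<noteq> 0 \<Longrightarrow> y \<noteq> 0 \<Longrightarrow> w (x * y) = w x + w y"
  using discrete by (auto simp: discrete_valuation_def)

lemma val_one [simp]: "w 1 = 0"
  using val_mult[of 1 1] by simp

lemma val_power: "x \<noteq> 0 \<Longrightarrow> w (x ^ n) = int n * w x"
  by (induction n) (simp_all add: val_mult algebra_simps)

lemma val_inverse: "x \<noteq> 0 \<Longrightarrow> w (inverse x) = - w x"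
  using val_mult[of x "inverse x"] by simp

lemma val_divide: "x \<noteq> 0 \<Longrightarrow> y \<noteq> 0 \<Longrightarrow> w (x / y) = w x - w y"
  by (simp add: divide_inverse val_mult val_inverse)

lemma val_minus: "w (- x) = w x"
proof (cases "x = 0")
  case False
  have "w ((-1) * (-1)) = w (-1) + w (-1)"
    by (rule val_mult) simp_all
  then have "w (-1) = 0" by simp
  then show ?thesis using val_mult[of "-1" x] False by simp
qed simp

lemma uniformiser_exists: "\<exists>\<pi>. \<pi> \<noteq> 0 \<and> w \<pi> = 1"
proof -
  have "1 \<in> w ` (UNIV - {0})"
    using discrete by (simp add: discrete_valuation_def)
  then show ?thesis by (metis DiffD2 imageE singletonI)
qed

lemma val_ge_zero [simp]: "val_ge w N 0"
  by (simp add: val_ge_def)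

lemma val_ge_one [simp]: "val_ge w 0 1" "\<not> val_ge w 1 1"
  by (simp_all add: val_ge_def)

lemma val_ge_mono: "val_ge w N x \<Longrightarrow> M \<le> N \<Longrightarrow> val_ge w M x"
  by (auto simp: val_ge_def)

lemma val_ge_add: "val_ge w N x \<Longrightarrow> val_ge w N y \<Longrightarrow> val_ge w N (x + y)"
proof (cases "x = 0 \<or> y = 0 \<or> x + y = 0")
  case False
  then have "min (w x) (w y) \<le> w (x + y)"
    using discrete by (auto simp: discrete_valuation_def)
  then show "val_ge w N x \<Longrightarrow> val_ge w N y \<Longrightarrow> ?thesis"
    using False by (auto simp: val_ge_def)
qed (auto simp: val_ge_def)

lemma val_ge_minus [simp]: "val_ge w N (- x) \<longleftrightarrow> val_ge w N x"
  by (simp add: val_ge_def val_minus)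

lemma val_ge_commute: "val_ge w N (x - y) \<longleftrightarrow> val_ge w N (y - x)"
  using val_ge_minus[of N "x - y"] by simp

lemma val_ge_diff: "val_ge w N x \<Longrightarrow> val_ge w N y \<Longrightarrow> val_ge w N (x - y)"
  using val_ge_add[of N x "- y"] by simp

lemma val_ge_mult: "val_ge w M x \<Longrightarrow> val_ge w N y \<Longrightarrow> val_ge w (M + N) (x * y)"
  by (cases "x = 0 \<or> y = 0") (auto simp: val_ge_def val_mult)

lemma val_ge_mult0: "val_ge w 0 x \<Longrightarrow> val_ge w N y \<Longrightarrow> val_ge w N (x * y)"
    "val_ge w N x \<Longrightarrow> val_ge w 0 y \<Longrightarrow> val_ge w N (x * y)"
  using val_ge_mult[of 0 x N y] val_ge_mult[of N x 0 y] by simp_all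

lemma val_ge_sum: "(\<And>a. a \<in> A \<Longrightarrow> val_ge w N (h a)) \<Longrightarrow> val_ge w N (sum h A)"
  by (induction A rule: infinite_finite_induct) (simp_all add: val_ge_add)

lemma val_ge_power: "val_ge w 0 x \<Longrightarrow> val_ge w 0 (x ^ n)"
  by (induction n) (simp_all add: val_ge_mult0)

lemma val_ge_of_nat [simp]: "val_ge w 0 (of_nat n)"
  by (induction n) (simp_all add: val_ge_add)

lemma val_ge_divide_iff: "c \<noteq> 0 \<Longrightarrow> val_ge w N (x / c) \<longleftrightarrow> val_ge w (N + w c) x"
  by (cases "x = 0") (auto simp: val_ge_def val_divide)

lemma val_ge_imp_0: "(\<And>N. val_ge w N x) \<Longrightarrow> x = 0"
  by (metis val_ge_def less_add_one linorder_not_less)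

lemma unit_iff: "x \<noteq> 0 \<and> w x = 0 \<longleftrightarrow> val_ge w 0 x \<and> \<not> val_ge w 1 x"
  by (auto simp: val_ge_def)

lemma cong_trans: "x \<approx> y \<Longrightarrow> y \<approx> z \<Longrightarrow> x \<approx> z"
  using val_ge_add[of 1 "x - y" "y - z"] by simp

lemma cong_sym: "x \<approx> y \<Longrightarrow> y \<approx> x"
  by (simp add: val_ge_commute)

lemma cong_val_ge: "x \<approx> y \<Longrightarrow> val_ge w 0 y \<Longrightarrow> val_ge w 0 x"
  using val_ge_add[of 0 "x - y" y] val_ge_mono by fastforce

lemma cong_mult:
  assumes "x \<approx> x'" "y \<approx> y'" "val_ge w 0 x'" "val_ge w 0 y'"
  shows "x * y \<approx> x' * y'"
proof -
  have "x * y - x' * y' = (x - x') * y + x' * (y - y')"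
    by (simp add: algebra_simps)
  then show ?thesis
    using assms cong_val_ge val_ge_mult0 by (metis val_ge_add)
qed

lemma cong_power: "x \<approx> y \<Longrightarrow> val_ge w 0 y \<Longrightarrow> x ^ n \<approx> y ^ n"
  by (induction n) (simp_all add: cong_mult val_ge_power)

lemma cong_1_unit:
  assumes "x \<approx> 1"
  shows "x \<noteq> 0" "w x = 0"
proof -
  have "val_ge w 0 x" using assms cong_val_ge by simp
  moreover have "\<not> val_ge w 1 x"
    using assms val_ge_diff[of 1 x "x - 1"] by auto
  ultimately show "x \<noteq> 0" "w x = 0" using unit_iff by blast+
qed

lemma root_of_unity_val:
  assumes "x ^ n = 1" "n > 0"
  shows "x \<noteq> 0" "w x = 0"
proof -
  show "x \<noteq> 0" using assms by (metis power_0_left one_neq_zero less_numeral_extra(3))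
  then show "w x = 0" using assms val_power[of x n] by simp
qed

text \<open>Newton's iteration with the derivative frozen at \<open>a\<close> is already a contraction of \<open>a + \<mm>\<close>.\<close>

lemma hensel_radical:
  assumes complete: "complete_valuation w"
    and n: "\<not> val_ge w 1 (of_nat n)"
    and a: "a \<noteq> 0" "w a = 0" and ab: "a ^ n \<approx> b"
  shows "\<exists>x. x ^ n = b \<and> x \<approx> a"
proof -
  have n': "of_nat n \<noteq> (0::'a)" "w (of_nat n) = 0"
    using n unit_iff val_ge_of_nat by blast+
  then have "n > 0" by (cases n) auto
  \<comment> \<open>The derivative of x^n at \<open>a\<close>, a unit because \<open>n\<close> and
    \<open>a\<close> are units.\<close>
  define d where "d = of_nat n * a ^ (n - 1)"
  have d: "d \<noteq> 0" "w d = 0"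
    using a n' by (simp_all add: d_def val_mult val_power)
  have va: "val_ge w 0 a" using a by (simp add: val_ge_def)
  define \<phi> where "\<phi> x = x - (x ^ n - b) / d" for x
  have O: "val_ge w 0 x" if "x \<approx> a" for x
    using cong_val_ge that va by blast
  have stable: "\<phi> x \<approx> a" if "x \<approx> a" for x
  proof -
    have "x ^ n \<approx> b" using cong_power[OF that va] ab cong_trans by blast
    then have "val_ge w 1 ((x ^ n - b) / d)" using d by (simp add: val_ge_divide_iff)
    then have "val_ge w 1 ((x - a) - (x ^ n - b) / d)" using that val_ge_diff by blast
    then show ?thesis by (simp add: \<phi>_def algebra_simps)
  qed
  \<comment> \<open>Factor x^n - y^n = (x - y) S. Each of the n terms of S is congruent to a^(n-1),
    so S is congruent to \<open>d\<close>, and \<phi> x - \<phi> y = -(x - y)(S - d)/d gains one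
    unit of valuation.\<close>
  have contract: "val_ge w (N + 1) (\<phi> x - \<phi> y)"
    if "x \<approx> a" "y \<approx> a" "val_ge w N (x - y)" for x y N
  proof -
    let ?S = "\<Sum>k<n. y ^ (n - Suc k) * x ^ k"
    have "(\<Sum>k<n. a ^ (n - Suc k) * a ^ k) = (\<Sum>k<n. a ^ (n - 1))"
      by (rule sum.cong) (simp_all flip: power_add)
    then have "d = (\<Sum>k<n. a ^ (n - Suc k) * a ^ k)"
      by (simp add: d_def)
    then have "?S - d = (\<Sum>k<n. y ^ (n - Suc k) * x ^ k - a ^ (n - Suc k) * a ^ k)"
      by (simp add: sum_subtractf)
    also have "val_ge w 1 \<dots>"
      using that va by (intro val_ge_sum cong_mult cong_power val_ge_power) auto
    finally have "val_ge w 1 ((?S - d) / d)"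
      using d by (simp add: val_ge_divide_iff)
    then have "val_ge w (N + 1) ((x - y) * ((?S - d) / d))"
      using that(3) val_ge_mult by blast
    moreover have "\<phi> x - \<phi> y = - ((x - y) * ((?S - d) / d))"
    proof -
      have "\<phi> x - \<phi> y = (x - y) - (x ^ n - y ^ n) / d"
        by (simp add: \<phi>_def diff_divide_distrib)
      also have "x ^ n - y ^ n = (x - y) * ?S" by (rule power_diff_sumr2)
      finally show ?thesis using d by (simp add: field_simps)
    qed
    ultimately show ?thesis by (metis val_ge_minus)
  qed
  define s where "s k = (\<phi> ^^ k) a" for k
  have s: "s k \<approx> a" for k
    by (induction k) (simp_all add: s_def stable)
  have s_step: "val_ge w (int k + 1) (s (Suc k) - s k)" for k
  proof (induction k)
    case 0
    then show ?case using s[of 1] by (simp add: s_def)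
  next
    case (Suc k)
    then show ?case using contract[OF s s Suc] by (simp add: s_def add.commute)
  qed
  have s_le: "val_ge w (int k + 1) (s m - s k)" if "k \<le> m" for k m
    using that
  proof (induction m rule: dec_induct)
    case (step m)
    have "val_ge w (int k + 1) (s (Suc m) - s m)"
      using s_step[of m] val_ge_mono step by fastforce
    then show ?case
      using step.IH val_ge_add[of "int k + 1" "s (Suc m) - s m" "s m - s k"] by simp
  qed simp
  have "\<exists>M. \<forall>m\<ge>M. \<forall>n\<ge>M. val_ge w N (s m - s n)" for N
  proof (intro exI allI impI)
    fix m n assume mn: "nat N \<le> m" "nat N \<le> n"
    have "val_ge w (int (nat N) + 1) ((s m - s (nat N)) - (s n - s (nat N)))"
      by (intro val_ge_diff s_le mn)
    then show "val_ge w N (s m - s n)"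
      using val_ge_mono[of "int (nat N) + 1" _ N] by simp
  qed
  then obtain l where l: "\<And>N. \<exists>M. \<forall>n\<ge>M. val_ge w N (s n - l)"
    using complete unfolding complete_valuation_def by blast
  have la: "l \<approx> a"
    using l[of 1] s cong_sym cong_trans by blast
  \<comment> \<open>By contraction the iterates \<open>s (Suc M)\<close> approach \<phi> l as well
    as \<open>l\<close>; the difference has arbitrarily large valuation. A fixed point of \<phi> is
    a root.\<close>
  have "l - \<phi> l = 0"
  proof (rule val_ge_imp_0)
    fix N
    obtain M where M: "\<And>n. n \<ge> M \<Longrightarrow> val_ge w N (s n - l)" using l by blast
    have "val_ge w (N + 1) (\<phi> (s M) - \<phi> l)"
      by (rule contract[OF s la M]) simp
    then have "val_ge w N (s (Suc M) - \<phi> l)"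
      using val_ge_mono by (simp add: s_def)
    moreover have "val_ge w N (l - s (Suc M))" using M[of "Suc M"] val_ge_commute by simp
    ultimately show "val_ge w N (l - \<phi> l)"
      using val_ge_add[of N "l - s (Suc M)" "s (Suc M) - \<phi> l"] by simp
  qed
  then have "l ^ n = b" using d by (simp add: \<phi>_def)
  then show ?thesis using la by blast
qed

section \<open>The residue field through congruence classes\<close>

definition residue_class :: "'a \<Rightarrow> 'a set"
  where "residue_class x = {y. y \<approx> x}"

lemma residue_class_eq_iff: "residue_class x = residue_class y \<longleftrightarrow> x \<approx> y"
proof
  assume "residue_class x = residue_class y"
  moreover have "x \<in> residue_class x" by (simp add: residue_class_def)
  ultimately show "x \<approx> y" by (simp add: residue_class_def)
next
  assume "x \<approx> y"
  then show "residue_class x = residue_class y"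
    unfolding residue_class_def using cong_trans cong_sym by blast
qed

lemma valuation_ring_simps:
  "carrier (valuation_ring w) = {x. val_ge w 0 x}"
  "\<zero>\<^bsub>valuation_ring w\<^esub> = 0" "\<one>\<^bsub>valuation_ring w\<^esub> = 1"
  "x \<oplus>\<^bsub>valuation_ring w\<^esub> y = x + y" "x \<otimes>\<^bsub>valuation_ring w\<^esub> y = x * y"
  by (simp_all add: valuation_ring_def ring_of_type_algebra_def)

lemma valuation_ring_cring: "cring (valuation_ring w)"
proof (intro cringI abelian_groupI comm_monoidI)
  fix x assume "x \<in> carrier (valuation_ring w)"
  then show "\<exists>y\<in>carrier (valuation_ring w). y \<oplus>\<^bsub>valuation_ring w\<^esub> x = \<zero>\<^bsub>valuation_ring w\<^esub>"
    by (intro bexI[of _ "- x"]) (simp_all add: valuation_ring_simps)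
qed (simp_all add: valuation_ring_simps val_ge_add val_ge_mult0 algebra_simps)

text \<open>An ideal not contained in this one has an element of valuation 0. Its inverse is
  integral, so the ideal contains 1.\<close>

lemma maximal_ideal: "maximalideal {x. val_ge w 1 x} (valuation_ring w)"
proof -
  interpret R: cring "valuation_ring w" by (rule valuation_ring_cring)
  have R1: "val_ge w 1 x \<Longrightarrow> val_ge w 0 x" for x
    using val_ge_mono by simp
  have ainv: "a_inv (valuation_ring w) x = - x" if "val_ge w 0 x" for x
    by (rule R.minus_equality) (simp_all add: valuation_ring_simps that)
  have id: "ideal {x. val_ge w 1 x} (valuation_ring w)"
  proof (rule idealI)
    show "subgroup {x. val_ge w 1 x} (add_monoid (valuation_ring w))"
    proof (rule R.add.subgroupI)
      fix a assume "a \<in> {x. val_ge w 1 x}"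
      then show "a_inv (valuation_ring w) a \<in> {x. val_ge w 1 x}"
        using ainv[of a] R1 by simp
    qed (auto simp: valuation_ring_simps val_ge_add R1 intro!: exI[of _ 0])
  qed (auto simp: valuation_ring_simps val_ge_mult0 intro: R.ring_axioms)
  show ?thesis
  proof (rule maximalidealI[OF id])
    have "1 \<in> carrier (valuation_ring w)" "1 \<notin> {x. val_ge w 1 x}"
      by (simp_all add: valuation_ring_simps)
    then show "carrier (valuation_ring w) \<noteq> {x. val_ge w 1 x}" by blast
  next
    fix J assume J: "ideal J (valuation_ring w)" "{x. val_ge w 1 x} \<subseteq> J"
      "J \<subseteq> carrier (valuation_ring w)"
    interpret J: ideal J "valuation_ring w" by (rule J(1))
    show "J = {x. val_ge w 1 x} \<or> J = carrier (valuation_ring w)"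
    proof (cases "J \<subseteq> {x. val_ge w 1 x}")
      case False
      then obtain x where x: "x \<in> J" "\<not> val_ge w 1 x" by blast
      have "val_ge w 0 x" using x(1) J(3) by (auto simp: valuation_ring_simps)
      then have u: "x \<noteq> 0" "w x = 0" using x(2) unit_iff by blast+
      then have "inverse x \<in> carrier (valuation_ring w)"
        by (simp add: valuation_ring_simps val_ge_def val_inverse)
      then have "inverse x \<otimes>\<^bsub>valuation_ring w\<^esub> x \<in> J"
        using x(1) J.I_l_closed by blast
      then have "\<one>\<^bsub>valuation_ring w\<^esub> \<in> J" using u by (simp add: valuation_ring_simps)
      then show ?thesis using J.one_imp_carrier by blast
    qed (use J in blast)
  qed
qed

lemma residue_field_field: "field (residue_field w)"
  unfolding residue_field_def
  by (rule maximalideal.quotient_is_field[OF maximal_ideal valuation_ring_cring])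

lemma residue_class_coset:
  "{x. val_ge w 1 x} +>\<^bsub>valuation_ring w\<^esub> x = residue_class x"
proof -
  have "y \<in> residue_class x \<longleftrightarrow> (\<exists>h. val_ge w 1 h \<and> y = h + x)" for y
    unfolding residue_class_def by (auto intro!: exI[of _ "y - x"])
  then show ?thesis
    by (auto simp: a_r_coset_def' valuation_ring_simps)
qed

lemma carrier_residue_field: "carrier (residue_field w) = residue_class ` {x. val_ge w 0 x}"
  by (auto simp: residue_field_def FactRing_def A_RCOSETS_def' residue_class_coset valuation_ring_simps)

lemma residue_class_hom: "residue_class \<in> ring_hom (valuation_ring w) (residue_field w)"
proof -
  interpret maximalideal "{x. val_ge w 1 x}" "valuation_ring w" by (rule maximal_ideal)
  have "residue_class = (+>\<^bsub>valuation_ring w\<^esub>) {x. val_ge w 1 x}"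
    by (simp add: fun_eq_iff residue_class_coset)
  then show ?thesis
    using rcos_ring_hom by (simp add: residue_field_def)
qed

lemma residue_class_simps:
  assumes "val_ge w 0 x" "val_ge w 0 y"
  shows "residue_class x \<otimes>\<^bsub>residue_field w\<^esub> residue_class y = residue_class (x * y)"
    and "residue_class x \<oplus>\<^bsub>residue_field w\<^esub> residue_class y = residue_class (x + y)"
  using ring_hom_mult[OF residue_class_hom, of x y] ring_hom_add[OF residue_class_hom, of x y] assms
  by (simp_all add: valuation_ring_simps)

lemma residue_class_one: "\<one>\<^bsub>residue_field w\<^esub> = residue_class 1"
  using ring_hom_one[OF residue_class_hom] by (simp add: valuation_ring_simps)

lemma residue_class_zero: "\<zero>\<^bsub>residue_field w\<^esub> = residue_class 0"
  using ring_hom_zero[OF residue_class_hom] valuation_ring_cring residue_field_field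
  by (simp add: valuation_ring_simps cring.axioms(1) field_def domain_def)

text \<open>\<open>ring_char\<close> is the additive order of 1, so its multiples are the integers
  that vanish in the residue field. This turns the hypothesis on e and p into one about
  valuations.\<close>

lemma of_nat_residue:
  "val_ge w 1 (of_nat n) \<longleftrightarrow> ring_char (residue_field w) dvd n"
proof -
  interpret k: field "residue_field w" by (rule residue_field_field)
  have pow: "[n] \<cdot>\<^bsub>residue_field w\<^esub> \<one>\<^bsub>residue_field w\<^esub> = residue_class (of_nat n)" for n :: nat
    by (induction n) (simp_all add: residue_class_zero residue_class_one residue_class_simps add.commute)
  have "[n] \<cdot>\<^bsub>residue_field w\<^esub> \<one>\<^bsub>residue_field w\<^esub> = \<zero>\<^bsub>residue_field w\<^esub> \<longleftrightarrow>
      ring_char (residue_field w) dvd n"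
    unfolding ring_char_def by (rule k.add.pow_eq_id) simp
  then show ?thesis by (simp add: pow residue_class_zero residue_class_eq_iff)
qed

text \<open>Facts on the finite residue field restated as congruences: the additive order of 1
  divides Q, the multiplicative group is cyclic, and its order is Q - 1.\<close>

lemma residue_field_generator:
  assumes fin: "finite (carrier (residue_field w))"
  defines "Q \<equiv> card (carrier (residue_field w))"
  shows "Q > 1" "val_ge w 1 (of_nat Q)"
    and "\<exists>a. a \<noteq> 0 \<and> w a = 0 \<and> (\<forall>x. x \<noteq> 0 \<longrightarrow> w x = 0 \<longrightarrow> (\<exists>k. x \<approx> a ^ k))"
    and "\<And>x. x \<noteq> 0 \<Longrightarrow> w x = 0 \<Longrightarrow> x ^ (Q - 1) \<approx> 1"
proof -
  let ?k = "residue_field w"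
  interpret k: field ?k by (rule residue_field_field)
  have fin': "finite (carrier (Multiplicative_Group.mult_of ?k))"
    using fin k.finite_mult_of by blast
  have pow: "residue_class x [^]\<^bsub>?k\<^esub> n = residue_class (x ^ n)" if "val_ge w 0 x" for x and n :: nat
    by (induction n) (simp_all add: residue_class_one residue_class_simps val_ge_power that mult.commute)
  have carrier: "C \<in> carrier (Multiplicative_Group.mult_of ?k) \<longleftrightarrow>
      (\<exists>x. x \<noteq> 0 \<and> w x = 0 \<and> C = residue_class x)" for C
  proof -
    have "C \<in> carrier (Multiplicative_Group.mult_of ?k) \<longleftrightarrow>
        (\<exists>x. val_ge w 0 x \<and> C = residue_class x) \<and> C \<noteq> residue_class 0"
      by (auto simp: carrier_residue_field residue_class_zero)
    also have "\<dots> \<longleftrightarrow> (\<exists>x. (val_ge w 0 x \<and> \<not> val_ge w 1 x) \<and> C = residue_class x)"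
      using residue_class_eq_iff[of _ 0] by auto
    finally show ?thesis by (simp only: unit_iff[symmetric] conj_assoc)
  qed
  have "{\<zero>\<^bsub>?k\<^esub>, \<one>\<^bsub>?k\<^esub>} \<subseteq> carrier ?k" by simp
  then have "card {\<zero>\<^bsub>?k\<^esub>, \<one>\<^bsub>?k\<^esub>} \<le> Q" unfolding Q_def using fin by (rule card_mono[rotated])
  then show "Q > 1" by simp
  have "ring_char ?k dvd Coset.order (add_monoid ?k)"
    unfolding ring_char_def by (rule k.add.ord_dvd_group_order) simp
  then show "val_ge w 1 (of_nat Q)"
    unfolding of_nat_residue by (simp add: Q_def Coset.order_def)
  obtain C where C: "C \<in> carrier (Multiplicative_Group.mult_of ?k)"
      "carrier (Multiplicative_Group.mult_of ?k) = {C [^]\<^bsub>?k\<^esub> n | n::nat. n \<in> UNIV}"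
    using k.finite_field_mult_group_has_gen[OF fin] by blast
  obtain a where a: "a \<noteq> 0" "w a = 0" "C = residue_class a" using C carrier by blast
  have "\<exists>n. x \<approx> a ^ n" if "x \<noteq> 0" "w x = 0" for x
  proof -
    have "residue_class x \<in> carrier (Multiplicative_Group.mult_of ?k)"
      using that carrier by blast
    then obtain n :: nat where "residue_class x = C [^]\<^bsub>?k\<^esub> n" using C(2) by blast
    then show ?thesis
      using a pow[of a n] by (auto simp: residue_class_eq_iff val_ge_def)
  qed
  then show "\<exists>a. a \<noteq> 0 \<and> w a = 0 \<and> (\<forall>x. x \<noteq> 0 \<longrightarrow> w x = 0 \<longrightarrow> (\<exists>k. x \<approx> a ^ k))"
    using a by blast
  show "x ^ (Q - 1) \<approx> 1" if "x \<noteq> 0" "w x = 0" for x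
  proof -
    interpret G: group "Multiplicative_Group.mult_of ?k" by (rule k.field_mult_group)
    have "residue_class x [^]\<^bsub>Multiplicative_Group.mult_of ?k\<^esub> Coset.order (Multiplicative_Group.mult_of ?k) = \<one>\<^bsub>?k\<^esub>"
      using G.pow_order_eq_1[of "residue_class x"] that carrier by auto
    moreover have "Coset.order (Multiplicative_Group.mult_of ?k) = Q - 1"
      unfolding Q_def using k.order_mult_of[OF fin] by (simp add: Coset.order_def)
    ultimately have "residue_class (x ^ (Q - 1)) = residue_class 1"
      using pow[of x "Q - 1"] that residue_class_one
      by (simp add: Multiplicative_Group.nat_pow_mult_of val_ge_def)
    then show ?thesis by (simp add: residue_class_eq_iff)
  qed
qed

end

section \<open>Unramified extensions\<close>

locale unramified =
  fixes v :: "'k::field \<Rightarrow> int" and w :: "'m::field \<Rightarrow> int"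
    and i :: "'k \<Rightarrow> 'm" and f :: nat
  assumes local_field: "local_field v"
    and unramified: "unramified_extension v w i f"

sublocale unramified \<subseteq> V: valued_field v
  using local_field by unfold_locales (simp add: local_field_def)

sublocale unramified \<subseteq> W: valued_field w
  using unramified by unfold_locales (simp add: unramified_extension_def)

sublocale unramified \<subseteq> field_hom i
  using unramified by (simp add: unramified_extension_def field_embedding_iff)

lemma complete_valuationD:
  fixes s :: "nat \<Rightarrow> 'a::field"
  assumes "complete_valuation v" "\<And>N. \<exists>M. \<forall>m\<ge>M. \<forall>n\<ge>M. val_ge v N (s m - s n)"
  shows "\<exists>l. \<forall>N. \<exists>M. \<forall>n\<ge>M. val_ge v N (s n - l)"
  using assms unfolding complete_valuation_def by blast

lemma (in field_hom) vector_space_embedding: "vector_space (\<lambda>c x. i c * x)"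
  by unfold_locales (simp_all add: algebra_simps hom_add hom_mult)

section \<open>Integral bases, completeness and residue degree of K_f\<close>

context unramified
begin

lemma val_embedding [simp]: "val_ge w N (i x) \<longleftrightarrow> val_ge v N x"
  using unramified by (cases "x = 0") (auto simp: val_ge_def unramified_extension_def)

lemma embedding_val: "x \<noteq> 0 \<Longrightarrow> w (i x) = v x"
  using unramified by (simp add: unramified_extension_def)

text \<open>The residues of the members of U form a family linearly independent over the residue
  field of K; in particular distinct members have distinct residues.\<close>

definition residually_independent :: "'m set \<Rightarrow> bool"
  where "residually_independent U \<longleftrightarrow> finite U \<and> (\<forall>u\<in>U. val_ge w 0 u) \<and>
    (\<forall>c. (\<forall>u\<in>U. val_ge v 0 (c u)) \<longrightarrow> val_ge w 1 (\<Sum>u\<in>U. i (c u) * u) \<longrightarrow>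
      (\<forall>u\<in>U. val_ge v 1 (c u)))"

text \<open>Divide by a coefficient of least valuation. Were that valuation below N, the quotient
  would be an integral combination lying in the maximal ideal with one coefficient equal to 1,
  against independence. Ramification index 1 enters through w (i c) = v c.\<close>

lemma residually_independent_coeff:
  assumes U: "residually_independent U" and val: "val_ge w N (\<Sum>u\<in>U. i (c u) * u)"
    and u: "u \<in> U"
  shows "val_ge v N (c u)"
proof (rule ccontr)
  assume bad: "\<not> val_ge v N (c u)"
  have fin: "finite U" using U by (simp add: residually_independent_def)
  define A where "A = {u\<in>U. c u \<noteq> 0}"
  have A: "finite A" "u \<in> A" using fin u bad by (auto simp: A_def)
  define n where "n = Min ((\<lambda>u. v (c u)) ` A)"
  have "n \<in> (\<lambda>u. v (c u)) ` A" unfolding n_def using A by (intro Min_in) auto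
  then obtain u0 where u0: "u0 \<in> U" "c u0 \<noteq> 0" "v (c u0) = n" by (auto simp: A_def)
  have le: "n \<le> v (c u)" if "u \<in> U" "c u \<noteq> 0" for u
    unfolding n_def using A that by (intro Min_le) (auto simp: A_def)
  have "n < N" using le[OF u] bad by (auto simp: val_ge_def)
  have "val_ge v 0 (c u / c u0)" if "u \<in> U" for u
    using le[OF that] u0 by (cases "c u = 0") (simp_all add: val_ge_def V.val_divide)
  moreover have "(\<Sum>u\<in>U. i (c u / c u0) * u) = (\<Sum>u\<in>U. i (c u) * u) / i (c u0)"
    by (simp add: hom_divide sum_divide_distrib)
  then have "val_ge w 1 (\<Sum>u\<in>U. i (c u / c u0) * u)"
    using val \<open>n < N\<close> u0 W.val_ge_mono[OF val, of "1 + n"]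
    by (simp add: W.val_ge_divide_iff embedding_val)
  ultimately have "\<forall>u\<in>U. val_ge v 1 (c u / c u0)"
    using U unfolding residually_independent_def by (auto dest: spec[of _ "\<lambda>u. c u / c u0"])
  then have "val_ge v 1 (c u0 / c u0)" using u0(1) by blast
  then show False using u0 by simp
qed

text \<open>\<open>dim\<close> is the cardinality of a chosen basis, with default value 0 and
  \<open>card\<close> of an infinite set also 0. Positivity of the degree therefore yields a basis
  and its finiteness.\<close>

lemma basis_exists:
  "\<exists>B. finite B \<and> card B = f \<and> \<not> module.dependent (\<lambda>c x. i c * x) B \<and>
     module.span (\<lambda>c x. i c * x) B = UNIV"
proof -
  interpret vs: vector_space "\<lambda>c x. i c * x" by (rule vector_space_embedding)
  have f: "vs.dim UNIV = f" "f > 0"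
    using unramified by (auto simp: unramified_extension_def ext_degree_def)
  let ?P = "\<lambda>b. vs.independent b \<and> vs.span b = vs.span UNIV"
  have ex: "\<exists>b. ?P b"
    using f unfolding vs.dim_def by presburger
  then have card: "card (SOME b. ?P b) = f"
    using f unfolding vs.dim_def by presburger
  have "?P (SOME b. ?P b)" by (rule someI_ex[OF ex])
  moreover have "finite (SOME b. ?P b)" by (rule card_ge_0_finite) (simp only: card f)
  ultimately show ?thesis using card unfolding vs.span_UNIV by blast
qed

text \<open>In a vanishing combination every coefficient has valuation at least N for all N, so it
  is 0.\<close>

lemma residually_independent_independent:
  assumes U: "residually_independent U"
  shows "\<not> module.dependent (\<lambda>c x. i c * x) U"
proof -
  interpret vs: vector_space "\<lambda>c x. i c * x" by (rule vector_space_embedding)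
  have fin: "finite U" using U by (simp add: residually_independent_def)
  have "c u = 0" if "(\<Sum>u\<in>U. i (c u) * u) = 0" "u \<in> U" for c u
    by (rule V.val_ge_imp_0, rule residually_independent_coeff[OF U]) (simp_all add: that)
  then show ?thesis
    unfolding vs.dependent_finite[OF fin] by blast
qed

lemma residually_independent_card:
  assumes U: "residually_independent U"
  shows "card U \<le> f"
proof -
  interpret vs: vector_space "\<lambda>c x. i c * x" by (rule vector_space_embedding)
  obtain B where B: "finite B" "card B = f" "vs.span B = UNIV"
    using basis_exists by blast
  then show ?thesis
    using vs.independent_span_bound[of B U] residually_independent_independent[OF U] by auto
qed

text \<open>Small combinations have small coefficients, so each coordinate is a Cauchy sequence in K
  and converges there. This serves both the \<pi>-adic approximation for integral bases and the
  completeness of K_f.\<close>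

lemma coordinates_converge:
  fixes C :: "nat \<Rightarrow> 'm \<Rightarrow> 'k"
  assumes U: "residually_independent U"
    and cauchy: "\<And>N. \<exists>M. \<forall>m\<ge>M. \<forall>n\<ge>M.
      val_ge w N ((\<Sum>u\<in>U. i (C m u) * u) - (\<Sum>u\<in>U. i (C n u) * u))"
  shows "\<exists>l. \<forall>N. \<exists>M. \<forall>n\<ge>M. val_ge w N ((\<Sum>u\<in>U. i (C n u) * u) - (\<Sum>u\<in>U. i (l u) * u))"
proof -
  have fin: "finite U" and UO: "\<And>u. u \<in> U \<Longrightarrow> val_ge w 0 u"
    using U by (simp_all add: residually_independent_def)
  have diff: "(\<Sum>u\<in>U. i (a u) * u) - (\<Sum>u\<in>U. i (b u) * u) = (\<Sum>u\<in>U. i (a u - b u) * u)" for a b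
    by (simp add: hom_diff algebra_simps sum_subtractf)
  have "\<exists>l. \<forall>N. \<exists>M. \<forall>n\<ge>M. val_ge v N (C n u - l)" if u: "u \<in> U" for u
  proof -
    have "\<exists>M. \<forall>m\<ge>M. \<forall>n\<ge>M. val_ge v N (C m u - C n u)" for N
      using cauchy[of N] residually_independent_coeff[OF U _ u, of N "\<lambda>u. C _ u - C _ u"]
      unfolding diff by blast
    moreover have "complete_valuation v"
      using local_field by (simp add: local_field_def)
    ultimately show ?thesis using complete_valuationD[of v "\<lambda>n. C n u"] by blast
  qed
  then obtain l where l: "\<And>u N. u \<in> U \<Longrightarrow> \<exists>M. \<forall>n\<ge>M. val_ge v N (C n u - l u)"
    by metis
  have "\<exists>M. \<forall>n\<ge>M. val_ge w N ((\<Sum>u\<in>U. i (C n u) * u) - (\<Sum>u\<in>U. i (l u) * u))" for N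
  proof -
    \<comment> \<open>Finiteness of U gives one bound M for all coordinates.\<close>
    have "\<forall>\<^sub>F n in sequentially. \<forall>u\<in>U. val_ge v N (C n u - l u)"
      using l by (intro eventually_ball_finite[OF fin]) (simp add: eventually_sequentially)
    then obtain M where M: "\<And>n u. n \<ge> M \<Longrightarrow> u \<in> U \<Longrightarrow> val_ge v N (C n u - l u)"
      unfolding eventually_sequentially by blast
    show ?thesis
      unfolding diff using M UO by (auto intro!: exI[of _ M] W.val_ge_sum W.val_ge_mult0(2))
  qed
  then show ?thesis by blast
qed

definition integral_basis :: "'m set \<Rightarrow> bool"
  where "integral_basis U \<longleftrightarrow> residually_independent U \<and>
    (\<forall>x. val_ge w 0 x \<longrightarrow> (\<exists>c. (\<forall>u\<in>U. val_ge v 0 (c u)) \<and> x = (\<Sum>u\<in>U. i (c u) * u)))"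

text \<open>Successive approximation: a uniformiser \<pi> of K is one of K_f too, so an error
  divisible by \<pi>^n can be divided by it, approximated modulo the maximal ideal, and corrected to
  order n + 1. The coordinates converge.\<close>

lemma integral_basisI:
  assumes U: "residually_independent U"
    and gen: "\<And>x. val_ge w 0 x \<Longrightarrow>
      \<exists>c. (\<forall>u\<in>U. val_ge v 0 (c u)) \<and> val_ge w 1 (x - (\<Sum>u\<in>U. i (c u) * u))"
  shows "integral_basis U"
  unfolding integral_basis_def
proof (intro conjI U allI impI)
  fix x assume x: "val_ge w 0 x"
  obtain \<pi> where \<pi>: "\<pi> \<noteq> 0" "v \<pi> = 1" using V.uniformiser_exists by blast
  have "\<exists>c. val_ge w (int n) (x - (\<Sum>u\<in>U. i (c u) * u))" for n
  proof (induction n)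
    case 0
    show ?case using x by (intro exI[of _ "\<lambda>_. 0"]) simp
  next
    case (Suc n)
    then obtain c where c: "val_ge w (int n) (x - (\<Sum>u\<in>U. i (c u) * u))" by blast
    define y where "y = (x - (\<Sum>u\<in>U. i (c u) * u)) / i (\<pi> ^ n)"
    have "val_ge w 0 y"
      unfolding y_def using c \<pi> by (simp add: W.val_ge_divide_iff embedding_val V.val_power)
    then obtain d where d: "val_ge w 1 (y - (\<Sum>u\<in>U. i (d u) * u))" using gen by blast
    have "i (\<pi> ^ n) * y = x - (\<Sum>u\<in>U. i (c u) * u)"
      using \<pi> by (simp add: y_def)
    then have "x - (\<Sum>u\<in>U. i (c u + \<pi> ^ n * d u) * u) = i (\<pi> ^ n) * (y - (\<Sum>u\<in>U. i (d u) * u))"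
      by (simp add: right_diff_distrib hom_add hom_mult distrib_right sum.distrib
          sum_distrib_left mult.assoc)
    also have "val_ge w (int n + 1) \<dots>"
      by (rule W.val_ge_mult[OF _ d]) (use \<pi> in \<open>simp add: val_ge_def V.val_power embedding_val\<close>)
    finally show ?case by (intro exI[of _ "\<lambda>u. c u + \<pi> ^ n * d u"]) (simp add: add.commute)
  qed
  then obtain C where C: "\<And>n. val_ge w (int n) (x - (\<Sum>u\<in>U. i (C n u) * u))" by metis
  have "\<exists>M. \<forall>m\<ge>M. \<forall>n\<ge>M.
      val_ge w N ((\<Sum>u\<in>U. i (C m u) * u) - (\<Sum>u\<in>U. i (C n u) * u))" for N
  proof (intro exI allI impI)
    fix m n assume "nat N \<le> m" "nat N \<le> n"
    then have "val_ge w N (x - (\<Sum>u\<in>U. i (C m u) * u))" "val_ge w N (x - (\<Sum>u\<in>U. i (C n u) * u))"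
      using W.val_ge_mono[OF C] by simp_all
    then show "val_ge w N ((\<Sum>u\<in>U. i (C m u) * u) - (\<Sum>u\<in>U. i (C n u) * u))"
      using W.val_ge_diff[of N "x - (\<Sum>u\<in>U. i (C n u) * u)" "x - (\<Sum>u\<in>U. i (C m u) * u)"] by simp
  qed
  then obtain l where l: "\<And>N. \<exists>M. \<forall>n\<ge>M.
      val_ge w N ((\<Sum>u\<in>U. i (C n u) * u) - (\<Sum>u\<in>U. i (l u) * u))"
    using coordinates_converge[OF U] by blast
  have "x - (\<Sum>u\<in>U. i (l u) * u) = 0"
  proof (rule W.val_ge_imp_0)
    fix N
    obtain M where M: "\<And>n. n \<ge> M \<Longrightarrow> val_ge w N ((\<Sum>u\<in>U. i (C n u) * u) - (\<Sum>u\<in>U. i (l u) * u))"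
      using l by blast
    let ?n = "max M (nat N)"
    have "val_ge w N (x - (\<Sum>u\<in>U. i (C ?n u) * u))"
      by (rule W.val_ge_mono[OF C]) simp
    then show "val_ge w N (x - (\<Sum>u\<in>U. i (l u) * u))"
      using M[of ?n] W.val_ge_add by fastforce
  qed
  then have xl: "x = (\<Sum>u\<in>U. i (l u) * u)" by simp
  then have "\<forall>u\<in>U. val_ge v 0 (l u)"
    using residually_independent_coeff[OF U] x by blast
  then show "\<exists>c. (\<forall>u\<in>U. val_ge v 0 (c u)) \<and> x = (\<Sum>u\<in>U. i (c u) * u)"
    using xl by blast
qed

text \<open>A residually independent subset of Z of greatest size generates all residues. Z is kept
  general so that the basis can later be taken among powers of a root of unity.\<close>

lemma integral_basis_exists:
  assumes Z: "\<And>z. z \<in> Z \<Longrightarrow> val_ge w 0 z"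
    and reps: "\<And>x. x \<noteq> 0 \<Longrightarrow> w x = 0 \<Longrightarrow> \<exists>z\<in>Z. val_ge w 1 (x - z)"
  shows "\<exists>U. U \<subseteq> Z \<and> integral_basis U"
proof -
  let ?P = "\<lambda>U. U \<subseteq> Z \<and> residually_independent U"
  have "?P {}" by (simp add: residually_independent_def)
  then obtain U where U: "U \<subseteq> Z" "residually_independent U"
    and max: "\<And>U'. U' \<subseteq> Z \<Longrightarrow> residually_independent U' \<Longrightarrow> card U' \<le> card U"
    \<comment> \<open>Sizes are at most f; \<open>Suc f\<close> is the strict bound.\<close>
    using ex_has_greatest_nat[of ?P "{}" card "Suc f"] residually_independent_card
    unfolding less_Suc_eq_le by blast
  have fin: "finite U" using U by (simp add: residually_independent_def)
  have gen_Z: "\<exists>c. (\<forall>u\<in>U. val_ge v 0 (c u)) \<and> val_ge w 1 (z - (\<Sum>u\<in>U. i (c u) * u))"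
    if z: "z \<in> Z" for z
  proof (cases "z \<in> U")
    case True
    then have "(\<Sum>u\<in>U. i (if u = z then 1 else 0) * u) = z"
      using fin by (simp add: if_distrib[of i] if_distrib[of "\<lambda>x. x * _"] cong: if_cong)
    then show ?thesis by (intro exI[of _ "\<lambda>u. if u = z then 1 else 0"]) simp
  next
    case False
    have "\<not> residually_independent (insert z U)"
      using max[of "insert z U"] z U False fin by auto
    then obtain c u0 where c: "\<forall>u\<in>insert z U. val_ge v 0 (c u)"
        "val_ge w 1 (\<Sum>u\<in>insert z U. i (c u) * u)" "u0 \<in> insert z U" "\<not> val_ge v 1 (c u0)"
      using fin U Z z unfolding residually_independent_def by auto
    have sum: "val_ge w 1 (i (c z) * z + (\<Sum>u\<in>U. i (c u) * u))"
      using c(2) fin False by simp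
    \<comment> \<open>Otherwise the term of \<open>z\<close> could be dropped, and the independence
      of U would put every coefficient in the maximal ideal. As \<open>c z\<close> is a unit, the
      relation can be solved for \<open>z\<close>.\<close>
    have "\<not> val_ge v 1 (c z)"
    proof
      assume cz: "val_ge v 1 (c z)"
      then have "val_ge w 1 (i (c z) * z)" using Z[OF z] W.val_ge_mult0(2) by simp
      then have "val_ge w 1 (\<Sum>u\<in>U. i (c u) * u)"
        using W.val_ge_diff[OF sum, of "i (c z) * z"] by simp
      then have "\<forall>u\<in>U. val_ge v 1 (c u)"
        using c(1) U(2) unfolding residually_independent_def by blast
      then show False using cz c by auto
    qed
    then have cz: "c z \<noteq> 0" "v (c z) = 0" using c(1) V.unit_iff by blast+
    have "z - (\<Sum>u\<in>U. i (- c u / c z) * u) = (i (c z) * z + (\<Sum>u\<in>U. i (c u) * u)) / i (c z)"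
      using cz by (simp add: hom_divide hom_uminus add_divide_distrib sum_divide_distrib sum_negf)
    then have "val_ge w 1 (z - (\<Sum>u\<in>U. i (- c u / c z) * u))"
      using sum cz by (simp add: W.val_ge_divide_iff embedding_val)
    moreover have "\<forall>u\<in>U. val_ge v 0 (- c u / c z)"
      using c(1) cz by (simp add: V.val_ge_divide_iff)
    ultimately show ?thesis by (intro exI[of _ "\<lambda>u. - c u / c z"] conjI)
  qed
  have "integral_basis U"
  proof (rule integral_basisI[OF U(2)])
    fix x assume x: "val_ge w 0 x"
    show "\<exists>c. (\<forall>u\<in>U. val_ge v 0 (c u)) \<and> val_ge w 1 (x - (\<Sum>u\<in>U. i (c u) * u))"
    proof (cases "val_ge w 1 x")
      case True
      then show ?thesis by (intro exI[of _ "\<lambda>_. 0"]) simp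
    next
      case False
      then have "x \<noteq> 0" "w x = 0" using x W.unit_iff by blast+
      then obtain z where "z \<in> Z" "val_ge w 1 (x - z)" using reps by blast
      then show ?thesis using gen_Z[of z] W.cong_trans by blast
    qed
  qed
  then show ?thesis using U by blast
qed

lemma integral_basis_span:
  assumes "integral_basis U"
  shows "\<exists>c. x = (\<Sum>u\<in>U. i (c u) * u)"
proof (cases "x = 0")
  case True
  then show ?thesis by (intro exI[of _ "\<lambda>_. 0"]) simp
next
  case False
  obtain \<pi> where \<pi>: "\<pi> \<noteq> 0" "v \<pi> = 1" using V.uniformiser_exists by blast
  \<comment> \<open>This power clears denominators; \<open>nat\<close> makes the exponent 0 when x
    is already integral.\<close>
  define a where "a = \<pi> ^ nat (- w x)"
  have a: "a \<noteq> 0" "v a = int (nat (- w x))" using \<pi> by (simp_all add: a_def V.val_power)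
  have "val_ge w 0 (i a * x)"
    using a False by (simp add: val_ge_def W.val_mult embedding_val)
  then obtain c where "i a * x = (\<Sum>u\<in>U. i (c u) * u)"
    using assms unfolding integral_basis_def by blast
  then have "x = (\<Sum>u\<in>U. i (c u / a) * u)"
    using a by (simp add: hom_divide field_simps flip: sum_divide_distrib)
  then show ?thesis by (rule exI[of _ "\<lambda>u. c u / a"])
qed

text \<open>Residual independence bounds the size above by f, and spanning K_f over K bounds it
  below.\<close>

lemma integral_basis_card:
  assumes "integral_basis U"
  shows "card U = f"
proof -
  interpret vs: vector_space "\<lambda>c x. i c * x" by (rule vector_space_embedding)
  have U: "residually_independent U" "finite U"
    using assms by (simp_all add: integral_basis_def residually_independent_def)
  obtain B where B: "finite B" "card B = f" "vs.independent B" using basis_exists by blast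
  have "(\<Sum>u\<in>U. i (c u) * u) \<in> vs.span U" for c
    by (rule vs.span_sum, rule vs.span_scale, rule vs.span_base)
  then have "x \<in> vs.span U" for x
    using integral_basis_span[OF assms, of x] by auto
  then have "f \<le> card U"
    using vs.independent_span_bound[OF U(2) B(3)] B by blast
  then show ?thesis using residually_independent_card[OF U(1)] by simp
qed

lemma some_integral_basis: "\<exists>U. integral_basis U"
  using integral_basis_exists[of "{x. val_ge w 0 x}"] W.unit_iff
  by (metis (mono_tags) W.val_ge_zero diff_self mem_Collect_eq)

lemma complete: "complete_valuation w"
  unfolding complete_valuation_def
proof (intro allI impI)
  fix s :: "nat \<Rightarrow> 'm" assume s: "\<forall>N. \<exists>M. \<forall>m\<ge>M. \<forall>n\<ge>M. val_ge w N (s m - s n)"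
  obtain U where U: "integral_basis U" using some_integral_basis by blast
  have "\<exists>C. \<forall>n. s n = (\<Sum>u\<in>U. i (C n u) * u)"
    by (rule choice, rule allI, rule integral_basis_span[OF U])
  then obtain C where C: "\<And>n. s n = (\<Sum>u\<in>U. i (C n u) * u)" by blast
  show "\<exists>l. \<forall>N. \<exists>M. \<forall>n\<ge>M. val_ge w N (s n - l)"
    using coordinates_converge[of U C] s U unfolding C integral_basis_def by (elim conjE exE) blast
qed

text \<open>Reducing the coordinates in an integral basis U identifies the residue field of K_f with
  the functions from U to the residue field of K, and U has f elements.\<close>

lemma card_residue_field:
  "card (carrier (residue_field w)) = card (carrier (residue_field v)) ^ f"
    and finite_residue_field: "finite (carrier (residue_field w))"
proof -
  obtain U where U: "integral_basis U" using some_integral_basis by blast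
  have U': "residually_independent U" "finite U" "\<And>u. u \<in> U \<Longrightarrow> val_ge w 0 u"
    using U by (simp_all add: integral_basis_def residually_independent_def)
  let ?k = "carrier (residue_field v)"
  have fin: "finite ?k" using local_field by (simp add: local_field_def)
  \<comment> \<open>An integral lift of each residue class, used to map coordinate functions back to
    elements of K_f.\<close>
  define r where "r C = (SOME x. val_ge v 0 x \<and> V.residue_class x = C)" for C
  have r: "val_ge v 0 (r C)" "V.residue_class (r C) = C" if C: "C \<in> ?k" for C
  proof -
    have "\<exists>x. val_ge v 0 x \<and> V.residue_class x = C"
      using C unfolding V.carrier_residue_field by blast
    then show "val_ge v 0 (r C)" "V.residue_class (r C) = C"
      unfolding r_def using someI_ex[of "\<lambda>x. val_ge v 0 x \<and> V.residue_class x = C"] by blast+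
  qed
  define F where "F c = W.residue_class (\<Sum>u\<in>U. i (r (c u)) * u)" for c
  have "bij_betw F (U \<rightarrow>\<^sub>E ?k) (carrier (residue_field w))"
    unfolding bij_betw_def
  proof
    show "inj_on F (U \<rightarrow>\<^sub>E ?k)"
    proof (rule inj_onI)
      fix c d assume cd: "c \<in> U \<rightarrow>\<^sub>E ?k" "d \<in> U \<rightarrow>\<^sub>E ?k" "F c = F d"
      have "val_ge w 1 (\<Sum>u\<in>U. i (r (c u) - r (d u)) * u)"
        using cd(3) unfolding F_def W.residue_class_eq_iff
        by (simp add: hom_diff algebra_simps sum_subtractf)
      then have "val_ge v 1 (r (c u) - r (d u))" if "u \<in> U" for u
        using residually_independent_coeff[OF U'(1), of 1 "\<lambda>u. r (c u) - r (d u)"] that by blast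
      then have "V.residue_class (r (c u)) = V.residue_class (r (d u))" if "u \<in> U" for u
        using that by (simp add: V.residue_class_eq_iff)
      moreover have "c u \<in> ?k" "d u \<in> ?k" if "u \<in> U" for u
        using cd that by auto
      ultimately have "c u = d u" if "u \<in> U" for u using that r(2) by simp
      then show "c = d" using cd PiE_ext by blast
    qed
    show "F ` (U \<rightarrow>\<^sub>E ?k) = carrier (residue_field w)"
    proof
      show "F ` (U \<rightarrow>\<^sub>E ?k) \<subseteq> carrier (residue_field w)"
      proof (rule image_subsetI)
        fix c assume "c \<in> U \<rightarrow>\<^sub>E ?k"
        then have "val_ge v 0 (r (c u))" if "u \<in> U" for u using that r(1) by auto
        then have "val_ge w 0 (\<Sum>u\<in>U. i (r (c u)) * u)"
          using U'(3) by (auto intro!: W.val_ge_sum W.val_ge_mult0(2))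
        then show "F c \<in> carrier (residue_field w)"
          unfolding F_def W.carrier_residue_field by blast
      qed
      show "carrier (residue_field w) \<subseteq> F ` (U \<rightarrow>\<^sub>E ?k)"
      proof
        fix Y assume "Y \<in> carrier (residue_field w)"
        then obtain x where x: "val_ge w 0 x" "Y = W.residue_class x"
          unfolding W.carrier_residue_field by blast
        obtain c where c: "\<forall>u\<in>U. val_ge v 0 (c u)" "x = (\<Sum>u\<in>U. i (c u) * u)"
          using U x(1) unfolding integral_basis_def by blast
        define d where "d = restrict (\<lambda>u. V.residue_class (c u)) U"
        have d: "V.residue_class (c u) \<in> ?k" if "u \<in> U" for u
          using c(1) that unfolding V.carrier_residue_field by blast
        then have "val_ge v 1 (c u - r (d u))" if "u \<in> U" for u
          using that r(2)[OF d[OF that]] unfolding V.residue_class_eq_iff[symmetric]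
          by (simp add: d_def)
        then have "val_ge w 1 (\<Sum>u\<in>U. i (c u - r (d u)) * u)"
          using U'(3) by (auto intro!: W.val_ge_sum W.val_ge_mult0(2))
        then have "F d = Y"
          using x(2) c(2) unfolding F_def
          by (simp add: W.residue_class_eq_iff hom_diff algebra_simps sum_subtractf W.val_ge_commute)
        moreover have "d \<in> U \<rightarrow>\<^sub>E ?k" using d by (auto simp: d_def)
        ultimately show "Y \<in> F ` (U \<rightarrow>\<^sub>E ?k)" by blast
      qed
    qed
  qed
  then have "card (U \<rightarrow>\<^sub>E ?k) = card (carrier (residue_field w))"
    "finite (U \<rightarrow>\<^sub>E ?k) = finite (carrier (residue_field w))"
    by (simp_all add: bij_betw_same_card bij_betw_finite)
  then show "card (carrier (residue_field w)) = card ?k ^ f" "finite (carrier (residue_field w))"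
    using card_PiE[OF U'(2), of "\<lambda>_. ?k"] integral_basis_card[OF U] finite_PiE[OF U'(2), of "\<lambda>_. ?k"] fin
    by simp_all
qed

end

section \<open>Algebraic elements and minimal polynomials\<close>

lemma (in field_hom) poly_map_sum_monom:
  "poly (map_poly i (\<Sum>k\<in>A. Polynomial.monom (c k) (n k))) x = (\<Sum>k\<in>A. i (c k) * x ^ n k)"
  by (induction A rule: infinite_finite_induct)
    (simp_all add: map_poly_add map_poly_monom poly_monom)

text \<open>The \<open>card I + 1\<close> powers of x are linearly dependent, and a dependence is a
  polynomial. Coinciding powers are treated apart, since \<open>dependent\<close> speaks of sets:
  there T^m - T^n does it.\<close>

lemma (in field_hom) finite_span_algebraic:
  assumes I: "finite I" and span: "\<And>x. \<exists>c. x = (\<Sum>k\<in>I. i (c k) * b k)"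
  shows "\<exists>p. p \<noteq> 0 \<and> poly (map_poly i p) x = 0"
proof (cases "inj_on (\<lambda>n. x ^ n) {..card I}")
  case False
  then obtain m n where mn: "m \<noteq> n" "x ^ m = x ^ n" by (auto simp: inj_on_def)
  define p :: "'a poly" where "p = Polynomial.monom 1 m - Polynomial.monom 1 n"
  have "coeff p m = 1" using mn by (simp add: p_def)
  then have "p \<noteq> 0" by auto
  moreover have "poly (map_poly i p) x = 0"
    using mn by (simp add: p_def map_poly_diff map_poly_monom poly_monom)
  ultimately show ?thesis by blast
next
  case True
  interpret vs: vector_space "\<lambda>c x. i c * x" by (rule vector_space_embedding)
  let ?P = "(\<lambda>n. x ^ n) ` {..card I}"
  have "(\<Sum>k\<in>I. i (c k) * b k) \<in> vs.span (b ` I)" for c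
    by (rule vs.span_sum, rule vs.span_scale, rule vs.span_base) simp
  then have "y \<in> vs.span (b ` I)" for y using span[of y] by auto
  moreover have "card ?P > card (b ` I)"
    using card_image[OF True] card_image_le[OF I, of b] by simp
  ultimately have "vs.dependent ?P"
    using vs.independent_span_bound[of "b ` I" ?P] I by fastforce
  then obtain u n where u: "(\<Sum>y\<in>?P. i (u y) * y) = 0" "n \<le> card I" "u (x ^ n) \<noteq> 0"
    by (auto simp: vs.dependent_finite)
  define p where "p = (\<Sum>k\<le>card I. Polynomial.monom (u (x ^ k)) k)"
  have p: "coeff p k = (if k \<le> card I then u (x ^ k) else 0)" for k
    by (simp add: p_def coeff_sum)
  have "p \<noteq> 0" using p[of n] u by auto
  moreover have "poly (map_poly i p) x = (\<Sum>k\<le>card I. i (u (x ^ k)) * x ^ k)"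
    unfolding p_def by (rule poly_map_sum_monom)
  moreover have "(\<Sum>k\<le>card I. i (u (x ^ k)) * x ^ k) = 0"
    using u(1) by (simp add: sum.reindex[OF True])
  ultimately show ?thesis by auto
qed

text \<open>Take a nonzero annihilating polynomial of least degree; the remainder of any other one
  on division by it annihilates x as well.\<close>

lemma (in field_hom) minimal_polynomial:
  assumes "p \<noteq> 0" "poly (map_poly i p) x = 0"
  shows "\<exists>g. g \<noteq> 0 \<and> (\<forall>h. poly (map_poly i h) x = 0 \<longleftrightarrow> g dvd h)"
proof -
  let ?R = "\<lambda>h. h \<noteq> 0 \<and> poly (map_poly i h) x = 0"
  obtain g where g: "?R g" and min: "\<And>h. ?R h \<Longrightarrow> degree g \<le> degree h"
    using ex_has_least_nat[of ?R p degree] assms by blast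
  have "g dvd h" if h: "poly (map_poly i h) x = 0" for h
  proof (rule ccontr)
    assume "\<not> g dvd h"
    then have r: "h mod g \<noteq> 0" by (simp add: dvd_eq_mod_eq_0)
    have "h mod g = h - g * (h div g)" by (rule minus_mult_div_eq_mod[symmetric])
    then have "poly (map_poly i (h mod g)) x = 0"
      using h g by (simp add: map_poly_diff map_poly_mult)
    then have "degree g \<le> degree (h mod g)" using r min by blast
    then show False using degree_mod_less'[OF _ r] g by fastforce
  qed
  then show ?thesis using g by (auto simp: map_poly_mult elim!: dvdE)
qed

lemma (in simple_ext) power_basis: "\<exists>c. x = (\<Sum>k<degree g. i (c k) * \<theta> ^ k)"
proof -
  obtain h where h: "x = poly (map_poly i h) \<theta>" "degree h < degree g"
    using generated_reduced by blast
  have "x = (\<Sum>k\<le>degree h. i (coeff h k) * \<theta> ^ k)"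
    using h by (simp add: poly_altdef)
  also have "\<dots> = (\<Sum>k<degree g. i (coeff h k) * \<theta> ^ k)"
    by (rule sum.mono_neutral_left) (use h in \<open>auto simp: coeff_eq_0\<close>)
  finally show ?thesis by blast
qed

lemma (in simple_ext) algebraic: "\<exists>p. p \<noteq> 0 \<and> poly (map_poly i p) x = 0"
  by (rule finite_span_algebraic[OF finite_lessThan power_basis])

section \<open>Counting roots of unity\<close>

lemma radical_dvd_radical:
  assumes "e dvd n"
  shows "Polynomial.monom (1::'a::field) e - [:1:] dvd Polynomial.monom 1 n - [:1:]"
proof -
  obtain t where t: "n = e * t" using assms by blast
  have "Polynomial.monom (1::'a) n - 1 = Polynomial.monom 1 e ^ t - 1"
    by (simp add: t monom_altdef power_mult)
  then show ?thesis
    by (simp add: power_diff_1_eq flip: one_pCons)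
qed

lemma card_roots_of_unity_dvd:
  assumes "card {x::'a::field. x ^ n = 1} = n" "n > 0" "e dvd n"
  shows "card {x::'a. x ^ e = 1} = e"
proof -
  have "e > 0" using assms by (metis dvd_0_left_iff gr0I less_numeral_extra(3))
  then show ?thesis
    using card_roots_dvd[OF radical_neq_0[OF assms(2)] radical_dvd_radical[OF assms(3), where 'a='a]] assms
    by (simp add: degree_radical poly_monom del: diff_pCons)
qed

text \<open>Lagrange's theorem for the roots of T^e - 1 as a subgroup of the roots of T^n -
  1.\<close>

lemma dvd_of_card_roots_of_unity:
  assumes e: "card {x::'a::field. x ^ e = 1} = e" "e > 0"
    and n: "card {x::'a. x ^ n = 1} = n" "n > 0"
    and sub: "\<And>x::'a. x ^ e = 1 \<Longrightarrow> x ^ n = 1"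
  shows "e dvd n"
proof -
  define G :: "'a monoid" where
    "G = \<lparr>carrier = {x. x ^ n = 1}, monoid.mult = (*), one = 1\<rparr>"
  have nz: "x \<noteq> 0" if "x ^ n = 1" for x :: 'a using that n(2) by (auto simp: power_0_left)
  interpret G: group G
  proof (rule groupI)
    fix x assume "x \<in> carrier G"
    then show "\<exists>y\<in>carrier G. y \<otimes>\<^bsub>G\<^esub> x = \<one>\<^bsub>G\<^esub>"
      using nz by (intro bexI[of _ "inverse x"]) (simp_all add: G_def power_inverse)
  qed (simp_all add: G_def power_mult_distrib)
  have "subgroup {x. x ^ e = 1} G"
  proof (rule G.subgroupI)
    fix a :: 'a assume a: "a \<in> {x. x ^ e = 1}"
    then have "inv\<^bsub>G\<^esub> a = inverse a"
      by (intro G.inv_equality) (use sub nz in \<open>simp_all add: G_def power_inverse\<close>)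
    then show "inv\<^bsub>G\<^esub> a \<in> {x. x ^ e = 1}" using a by (simp add: power_inverse)
  qed (auto simp: G_def power_mult_distrib sub intro!: exI[of _ 1])
  from G.lagrange[OF this] show ?thesis
    using e n by (metis G_def dvd_triv_right Coset.order_def partial_object.select_convs(1))
qed

section \<open>Roots of unity in K_f and its Galois group over K\<close>

context unramified
begin

definition N where "N = card (carrier (residue_field v)) ^ f - 1"

text \<open>\<open>N\<close> is the order of the multiplicative group of the residue field. Since N
  + 1 = q^f vanishes there, N reduces to -1, so Hensel's lemma applies to T^N - 1.\<close>

lemma N_pos: "N > 0" and unit_pow_N: "\<And>x. x \<noteq> 0 \<Longrightarrow> w x = 0 \<Longrightarrow> val_ge w 1 (x ^ N - 1)"
    and N_unit: "\<not> val_ge w 1 (of_nat N)"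
proof -
  note gen = W.residue_field_generator[OF finite_residue_field, unfolded card_residue_field]
  show "N > 0" using gen(1) by (simp add: N_def)
  show "\<And>x. x \<noteq> 0 \<Longrightarrow> w x = 0 \<Longrightarrow> val_ge w 1 (x ^ N - 1)" using gen(4) by (simp add: N_def)
  have "card (carrier (residue_field v)) ^ f = N + 1"
    using gen(1) by (simp add: N_def)
  then have "of_nat (card (carrier (residue_field v)) ^ f) = (of_nat N + 1 :: 'm)"
    by (simp only: of_nat_add of_nat_1)
  then show "\<not> val_ge w 1 (of_nat N)"
    using gen(2) W.val_ge_diff[of 1 "of_nat N + 1" "of_nat N"] by auto
qed

lemma teichmueller_lift:
  assumes "a \<noteq> 0" "w a = 0"
  shows "\<exists>x. x ^ N = 1 \<and> val_ge w 1 (x - a)"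
  using W.hensel_radical[OF complete N_unit assms unit_pow_N[OF assms]] .

text \<open>Each of the N nonzero residue classes contains such a root by Hensel's lemma; the degree
  gives the other bound.\<close>

lemma card_roots_N: "card {x::'m. x ^ N = 1} = N"
proof (rule antisym)
  show "card {x::'m. x ^ N = 1} \<le> N" using card_roots_of_unity_le N_pos by blast
  have "carrier (residue_field w) - {W.residue_class 0} \<subseteq> W.residue_class ` {x. x ^ N = 1}"
  proof
    fix C assume "C \<in> carrier (residue_field w) - {W.residue_class 0}"
    then obtain a where a: "val_ge w 0 a" "C = W.residue_class a" "\<not> val_ge w 1 a"
      unfolding W.carrier_residue_field using W.residue_class_eq_iff[of _ 0] by auto
    then have "a \<noteq> 0" "w a = 0" using W.unit_iff by blast+
    then obtain x where "x ^ N = 1" "val_ge w 1 (x - a)" using teichmueller_lift by blast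
    then show "C \<in> W.residue_class ` {x. x ^ N = 1}"
      using a W.residue_class_eq_iff by blast
  qed
  then have "card (carrier (residue_field w) - {W.residue_class 0}) \<le> card {x::'m. x ^ N = 1}"
    using card_roots_of_unity_le(1)[OF N_pos, where 'a='m] surj_card_le by metis
  moreover have "W.residue_class 0 \<in> carrier (residue_field w)"
    unfolding W.carrier_residue_field by simp
  ultimately show "N \<le> card {x::'m. x ^ N = 1}"
    using finite_residue_field card_residue_field by (simp add: N_def)
qed

lemma primitive_root:
  "\<exists>\<zeta>. \<zeta> ^ N = 1 \<and> (\<forall>x. x \<noteq> 0 \<longrightarrow> w x = 0 \<longrightarrow> (\<exists>k. val_ge w 1 (x - \<zeta> ^ k)))"
proof -
  obtain a where a: "a \<noteq> 0" "w a = 0" "\<And>x. x \<noteq> 0 \<Longrightarrow> w x = 0 \<Longrightarrow> \<exists>k. val_ge w 1 (x - a ^ k)"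
    using W.residue_field_generator(3)[OF finite_residue_field] by blast
  obtain \<zeta> where \<zeta>: "\<zeta> ^ N = 1" "val_ge w 1 (\<zeta> - a)" using teichmueller_lift[OF a(1,2)] by blast
  have "\<exists>k. val_ge w 1 (x - \<zeta> ^ k)" if "x \<noteq> 0" "w x = 0" for x
  proof -
    obtain k where "val_ge w 1 (x - a ^ k)" using a(3) \<open>x \<noteq> 0\<close> \<open>w x = 0\<close> by blast
    moreover have "val_ge w 1 (\<zeta> ^ k - a ^ k)"
      using W.cong_power[OF \<zeta>(2)] a by (simp add: val_ge_def)
    ultimately show ?thesis using W.cong_trans W.cong_sym by blast
  qed
  then show ?thesis using \<zeta> by blast
qed

text \<open>Powers of \<zeta> represent all nonzero residues, so an integral basis can be chosen
  among them and K_f = K(\<zeta>). A minimal polynomial of \<zeta> divides T^N - 1, which has N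
  roots in K_f.\<close>

lemma primitive_element:
  "\<exists>\<zeta> g. simple_ext i \<zeta> g \<and> card {y. poly (map_poly i g) y = 0} = degree g"
  and root_basis: "\<exists>U. integral_basis U \<and> (\<forall>u\<in>U. u ^ N = 1)"
proof -
  obtain \<zeta> where \<zeta>: "\<zeta> ^ N = 1" "\<And>x. x \<noteq> 0 \<Longrightarrow> w x = 0 \<Longrightarrow> \<exists>k. val_ge w 1 (x - \<zeta> ^ k)"
    using primitive_root by blast
  have pow: "(\<zeta> ^ k) ^ N = 1" for k
    using \<zeta>(1) by (metis mult.commute power_mult power_one)
  have "val_ge w 0 (\<zeta> ^ k)" for k
    using W.root_of_unity_val[OF pow N_pos, of k] by (simp add: val_ge_def)
  then obtain U where U: "U \<subseteq> range (\<lambda>k. \<zeta> ^ k)" "integral_basis U"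
    using integral_basis_exists[of "range (\<lambda>k. \<zeta> ^ k)"] \<zeta>(2) by blast
  then show "\<exists>U. integral_basis U \<and> (\<forall>u\<in>U. u ^ N = 1)"
    using pow by (intro exI[of _ U]) auto
  let ?X = "Polynomial.monom 1 N - [:1:] :: 'k poly"
  have X: "map_poly i ?X = Polynomial.monom 1 N - [:1:]"
    using map_poly_radical[of N 1] by simp
  have X0: "?X \<noteq> 0" by (rule radical_neq_0[OF N_pos])
  have "poly (map_poly i ?X) \<zeta> = 0" unfolding X using \<zeta>(1) by (simp only: poly_radical diff_self)
  then obtain g where g: "g \<noteq> 0" "\<And>h. poly (map_poly i h) \<zeta> = 0 \<longleftrightarrow> g dvd h"
    using minimal_polynomial[OF X0] by blast
  have "simple_ext i \<zeta> g"
  proof unfold_locales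
    fix x
    obtain c where c: "x = (\<Sum>u\<in>U. i (c u) * u)" using integral_basis_span[OF U(2)] by blast
    have "\<forall>u\<in>U. \<exists>k. u = \<zeta> ^ k" using U(1) by blast
    then obtain \<kappa> where \<kappa>: "\<And>u. u \<in> U \<Longrightarrow> u = \<zeta> ^ \<kappa> u" by metis
    have "x = (\<Sum>u\<in>U. i (c u) * \<zeta> ^ \<kappa> u)"
      unfolding c by (rule sum.cong) (simp_all flip: \<kappa>)
    then have "x = poly (map_poly i (\<Sum>u\<in>U. Polynomial.monom (c u) (\<kappa> u))) \<zeta>"
      by (simp only: poly_map_sum_monom)
    then show "\<exists>h. x = poly (map_poly i h) \<zeta>" ..
  qed (use g in auto)
  moreover have "card {y. poly (map_poly i g) y = 0} = degree (map_poly i g)"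
  proof (rule card_roots_dvd)
    show "map_poly i ?X \<noteq> 0" using X0 by simp
    show "map_poly i g dvd map_poly i ?X"
      by (rule map_poly_dvd) (use g \<open>poly (map_poly i ?X) \<zeta> = 0\<close> in blast)
    show "card {x. poly (map_poly i ?X) x = 0} = degree (map_poly i ?X)"
      unfolding X using card_roots_N
      by (simp only: poly_radical degree_radical[OF N_pos] right_minus_eq)
  qed
  ultimately show "\<exists>\<zeta> g. simple_ext i \<zeta> g \<and> card {y. poly (map_poly i g) y = 0} = degree g"
    by (auto simp: degree_map)
qed

lemma algebraic: "\<exists>p. p \<noteq> 0 \<and> poly (map_poly i p) x = 0"
  using primitive_element simple_ext.algebraic by blast

lemma endomorphism_in_galois_group:
  assumes "field_hom \<sigma>" "\<And>a. \<sigma> (i a) = i a"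
  shows "\<sigma> \<in> carrier (galois_group i)"
  unfolding galois_group_carrier
  using assms algebraic_endomorphism_surj[OF field_hom_axioms assms(1) algebraic] by blast

lemma galois_fixed_field:
  assumes "\<And>\<sigma>. \<sigma> \<in> carrier (galois_group i) \<Longrightarrow> \<sigma> x = x"
  shows "x \<in> range i"
proof -
  obtain \<zeta> g where "simple_ext i \<zeta> g" "card {y. poly (map_poly i g) y = 0} = degree g"
    using primitive_element by blast
  then show ?thesis
    using simple_ext.fixed_by_conjugations endomorphism_in_galois_group assms by metis
qed

text \<open>\<sigma> fixes K and sends a basis of roots of unity to roots of unity, so it preserves
  integrality. Units then go to units, and the general case follows by scaling with an element of
  K.\<close>

lemma galois_group_val:
  assumes \<sigma>: "\<sigma> \<in> carrier (galois_group i)" and x: "x \<noteq> 0"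
  shows "w (\<sigma> x) = w x"
proof -
  interpret s: field_hom \<sigma> using \<sigma> by (simp add: galois_group_carrier)
  have fix_base: "\<sigma> (i a) = i a" for a using \<sigma> by (simp add: galois_group_carrier)
  obtain U where U: "integral_basis U" "\<And>u. u \<in> U \<Longrightarrow> u ^ N = 1" using root_basis by blast
  have U_int: "val_ge w 0 (\<sigma> u)" if "u \<in> U" for u
  proof -
    have "(\<sigma> u) ^ N = 1" using U(2)[OF that] by (simp flip: s.hom_power)
    then show ?thesis using W.root_of_unity_val[OF _ N_pos] by (simp add: val_ge_def)
  qed
  have int: "val_ge w 0 (\<sigma> y)" if y: "val_ge w 0 y" for y
  proof -
    obtain c where c: "\<forall>u\<in>U. val_ge v 0 (c u)" "y = (\<Sum>u\<in>U. i (c u) * u)"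
      using U(1) y unfolding integral_basis_def by blast
    have "\<sigma> y = (\<Sum>u\<in>U. i (c u) * \<sigma> u)"
      unfolding c(2) by (simp add: s.hom_sum s.hom_mult fix_base)
    then show ?thesis using c(1) U_int by (simp add: W.val_ge_sum W.val_ge_mult0)
  qed
  \<comment> \<open>K already has elements of every valuation of K_f, the ramification index being
    1.\<close>
  obtain a where a: "a \<noteq> 0" "v a = w x"
  proof -
    have "w x \<in> v ` (UNIV - {0})" using V.discrete by (simp add: discrete_valuation_def)
    then show ?thesis using that by (metis DiffD2 imageE insertI1)
  qed
  define y where "y = x / i a"
  have y: "y \<noteq> 0" "w y = 0" using x a by (simp_all add: y_def W.val_divide embedding_val)
  have "val_ge w 0 (\<sigma> y)" "val_ge w 0 (inverse (\<sigma> y))"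
    using int[of y] int[of "inverse y"] y by (simp_all add: val_ge_def W.val_inverse s.hom_inverse)
  then have "w (\<sigma> y) = 0" using y by (simp add: val_ge_def W.val_inverse)
  moreover have "\<sigma> x = \<sigma> y * i a" using a by (simp add: y_def s.hom_divide fix_base)
  ultimately show ?thesis using a y by (simp add: W.val_mult embedding_val)
qed

end

section \<open>Ramified lines\<close>

abbreviation power_class :: "nat \<Rightarrow> 'a::field \<Rightarrow> 'a set"
  where "power_class e x \<equiv> eth_powers e #>\<^bsub>Multiplicative_Group.mult_of rng\<^esub> x"

lemma rng_simps [simp]:
  "carrier rng = UNIV" "\<zero>\<^bsub>rng\<^esub> = 0" "\<one>\<^bsub>rng\<^esub> = 1"
  "x \<oplus>\<^bsub>rng\<^esub> y = x + y" "x \<otimes>\<^bsub>rng\<^esub> y = x * y"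
  by (simp_all add: ring_of_type_algebra_def)

lemma mult_of_group: "comm_group (Multiplicative_Group.mult_of (rng :: 'a::field ring))"
proof (rule comm_groupI)
  fix x :: 'a assume "x \<in> carrier (Multiplicative_Group.mult_of rng)"
  then show "\<exists>y\<in>carrier (Multiplicative_Group.mult_of rng).
      y \<otimes>\<^bsub>Multiplicative_Group.mult_of rng\<^esub> x = \<one>\<^bsub>Multiplicative_Group.mult_of rng\<^esub>"
    by (intro bexI[of _ "inverse x"]) auto
qed simp_all

lemma power_class_eq: "power_class e x = {z ^ e * x | z. z \<noteq> 0}"
  unfolding r_coset_def eth_powers_def by auto

lemma power_class_self: "x \<in> power_class e x"
  unfolding power_class_eq by (auto intro!: exI[of _ 1])

lemma power_class_eqI:
  assumes "z \<noteq> 0" "x = z ^ e * y"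
  shows "power_class e x = power_class e y"
  unfolding power_class_eq
proof safe
  fix t :: 'a assume "t \<noteq> 0"
  then show "\<exists>s. t ^ e * x = s ^ e * y \<and> s \<noteq> 0"
    using assms by (intro exI[of _ "t * z"]) (simp add: power_mult_distrib)
next
  fix t :: 'a assume "t \<noteq> 0"
  then show "\<exists>s. t ^ e * y = s ^ e * x \<and> s \<noteq> 0"
    using assms by (intro exI[of _ "t / z"]) (simp add: power_divide)
qed

lemma power_class_eqD:
  assumes "power_class e x = power_class e y"
  shows "\<exists>z. z \<noteq> 0 \<and> x = z ^ e * y"
  using assms power_class_self[of x e] unfolding power_class_eq[of e y] by blast

lemma eth_powers_normal: "eth_powers e \<lhd> Multiplicative_Group.mult_of (rng :: 'a::field ring)"
proof -
  interpret G: comm_group "Multiplicative_Group.mult_of (rng :: 'a::field ring)"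
    by (rule mult_of_group)
  have "subgroup (eth_powers e) (Multiplicative_Group.mult_of (rng :: 'a ring))"
  proof (rule G.subgroupI)
    show "eth_powers e \<subseteq> carrier (Multiplicative_Group.mult_of (rng :: 'a ring))"
      by (auto simp: eth_powers_def)
    show "eth_powers e \<noteq> ({} :: 'a set)" by (auto simp: eth_powers_def intro!: exI[of _ 1])
  next
    fix a :: 'a assume "a \<in> eth_powers e"
    then obtain z where z: "a = z ^ e" "z \<noteq> 0" by (auto simp: eth_powers_def)
    have "inv\<^bsub>Multiplicative_Group.mult_of rng\<^esub> a = inverse z ^ e"
      by (rule G.inv_equality) (use z in \<open>simp_all add: power_inverse\<close>)
    then show "inv\<^bsub>Multiplicative_Group.mult_of rng\<^esub> a \<in> eth_powers e"
      using z by (auto simp: eth_powers_def)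
  next
    fix a b :: 'a assume "a \<in> eth_powers e" "b \<in> eth_powers e"
    then obtain z t where "a = z ^ e" "z \<noteq> 0" "b = t ^ e" "t \<noteq> 0" by (auto simp: eth_powers_def)
    then show "a \<otimes>\<^bsub>Multiplicative_Group.mult_of rng\<^esub> b \<in> eth_powers e"
      unfolding eth_powers_def
      by (auto intro!: exI[of _ "z * t"] simp: power_mult_distrib)
  qed
  then show ?thesis by (rule G.subgroup_imp_normal)
qed

lemma power_class_mult:
  assumes "x \<noteq> 0" "y \<noteq> (0::'a::field)"
  shows "power_class e x \<otimes>\<^bsub>power_classes e\<^esub> power_class e y = power_class e (x * y)"
  using normal.rcos_sum[OF eth_powers_normal, of x y e] assms
  by (simp add: power_classes_def FactGroup_def)

lemma power_classes_one: "\<one>\<^bsub>power_classes e\<^esub> = power_class e (1::'a::field)"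
  unfolding power_class_eq by (auto simp: power_classes_def FactGroup_def eth_powers_def)

lemma carrier_power_classes:
  "carrier (power_classes e) = power_class e ` (UNIV - {0::'a::field})"
  by (auto simp: power_classes_def FactGroup_def RCOSETS_def)

text \<open>A factor z^e changes the valuation by a multiple of e, so the image of the coset is a
  singleton and \<open>the_elem\<close> returns its member.\<close>

lemma (in valued_field) val_class_power_class:
  assumes "x \<noteq> 0"
  shows "val_class e w (power_class e x) = w x mod int e"
proof -
  have "w (z ^ e * x) mod int e = w x mod int e" if "z \<noteq> 0" for z
    using that assms by (simp add: val_mult val_power)
  then have "(\<lambda>x. w x mod int e) ` power_class e x = {w x mod int e}"
    using power_class_self[of x e] unfolding power_class_eq by force
  then show ?thesis by (simp add: val_class_def)
qed

context valued_field
begin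

lemma ramified_line_inj:
  assumes D: "ramified_line e w D" and xy: "power_class e x \<in> D" "power_class e y \<in> D"
    "x \<noteq> 0" "y \<noteq> 0" "w x mod int e = w y mod int e"
  shows "power_class e x = power_class e y"
proof -
  have "inj_on (val_class e w) D"
    using D by (auto simp: ramified_line_def iso_def bij_betw_def)
  then show ?thesis using xy val_class_power_class by (auto simp: inj_on_def)
qed

lemma ramified_line_finite:
  assumes "ramified_line e w D" "e > 0"
  shows "finite D"
proof -
  have "bij_betw (val_class e w) D {0..<int e}"
    using assms by (auto simp: ramified_line_def iso_def carrier_integer_mod_group)
  then show ?thesis using bij_betw_finite by blast
qed

lemma ramified_line_power:
  assumes D: "ramified_line e w D" and \<pi>: "power_class e \<pi> \<in> D" "\<pi> \<noteq> 0"
  shows "power_class e (\<pi> ^ k) \<in> D"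
proof (induction k)
  case 0
  have "\<one>\<^bsub>power_classes e\<^esub> \<in> D"
    using D by (simp add: ramified_line_def subgroup.one_closed)
  then show ?case by (simp add: power_classes_one)
next
  case (Suc k)
  have "power_class e \<pi> \<otimes>\<^bsub>power_classes e\<^esub> power_class e (\<pi> ^ k) \<in> D"
    using D Suc \<pi>(1) by (auto simp: ramified_line_def intro: subgroup.m_closed)
  then show ?case using power_class_mult[of \<pi> "\<pi> ^ k" e] \<pi>(2) by simp
qed

text \<open>A member of D is determined by its valuation modulo e, and \<pi> has valuation 1, so the
  residue of that valuation serves as exponent.\<close>

lemma ramified_line_generated:
  assumes D: "ramified_line e w D" "e > 0" and \<pi>: "power_class e \<pi> \<in> D" "\<pi> \<noteq> 0" "w \<pi> = 1"
    and C: "C \<in> D"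
  shows "\<exists>k. C = power_class e (\<pi> ^ k)"
proof -
  have "D \<subseteq> carrier (power_classes e)"
    using D by (simp add: ramified_line_def subgroup.subset)
  then obtain x where x: "x \<noteq> 0" "C = power_class e x"
    using C carrier_power_classes by blast
  define k where "k = nat (w x mod int e)"
  have "w (\<pi> ^ k) mod int e = w x mod int e"
    using \<pi> \<open>e > 0\<close> by (simp add: val_power k_def)
  then have "power_class e x = power_class e (\<pi> ^ k)"
    using C x \<pi>(2) by (intro ramified_line_inj[OF D(1) _ ramified_line_power[OF D(1) \<pi>(1,2)]]) simp_all
  then show ?thesis using x by blast
qed

end

lemma image_power_class:
  assumes "field_hom \<sigma>" "surj \<sigma>"
  shows "\<sigma> ` power_class e x = power_class e (\<sigma> x)"
proof -
  interpret s: field_hom \<sigma> by fact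
  have "y \<in> \<sigma> ` power_class e x" if y: "y \<in> power_class e (\<sigma> x)" for y
  proof -
    obtain z where z: "z \<noteq> 0" "y = z ^ e * \<sigma> x" using y unfolding power_class_eq by blast
    obtain t where t: "z = \<sigma> t" using assms(2) by (metis surjD)
    show ?thesis unfolding power_class_eq
      by (rule image_eqI[of _ _ "t ^ e * x"]) (use z t in \<open>auto simp: s.hom_mult s.hom_power\<close>)
  qed
  moreover have "\<sigma> ` power_class e x \<subseteq> power_class e (\<sigma> x)"
  proof
    fix y assume "y \<in> \<sigma> ` power_class e x"
    then obtain z where z: "z \<noteq> 0" "y = \<sigma> (z ^ e * x)" unfolding power_class_eq by blast
    then show "y \<in> power_class e (\<sigma> x)"
      unfolding power_class_eq by (auto simp: s.hom_mult s.hom_power intro!: exI[of _ "\<sigma> z"])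
  qed
  ultimately show ?thesis by blast
qed

lemma orbit_singleton_iff:
  "orbit (galois_group i) line_action D = {D} \<longleftrightarrow>
    (\<forall>\<sigma>\<in>carrier (galois_group i). line_action \<sigma> D = D)"
proof -
  have id: "id \<in> carrier (galois_group i)"
    by (simp add: galois_group_carrier field_hom_id)
  have "line_action id D = D" by (auto simp: line_action_def)
  then show ?thesis using id by (auto simp: orbit_def)
qed

section \<open>Totally ramified radical extensions\<close>

text \<open>Composing \<psi> with the quotient map gives a surjective ring homomorphism
  \<open>ev\<close> from K_f[T] to L with kernel generated by T^e - \<pi>. It is evaluation at the
  image \<theta> of T.\<close>

lemma radical_extension_simple:
  fixes j :: "'a::field \<Rightarrow> 'b::field"
  assumes "radical_extension e w D j" and "e > 0"
  shows "\<exists>\<pi> \<theta>. \<pi> \<noteq> 0 \<and> w \<pi> = 1 \<and> power_class e \<pi> \<in> D \<and>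
    simple_ext j \<theta> (Polynomial.monom 1 e - [:\<pi>:])"
proof -
  obtain \<pi> \<psi> where \<pi>: "\<pi> \<noteq> 0" "w \<pi> = 1" "power_class e \<pi> \<in> D"
    and \<psi>: "\<psi> \<in> ring_iso (rng Quot radical_quotient_ideal e \<pi>) rng"
    and base: "\<And>a. \<psi> (radical_quotient_ideal e \<pi> +>\<^bsub>rng\<^esub> [:a:]) = j a"
    using assms unfolding radical_extension_def by blast
  define g where "g = Polynomial.monom 1 e - [:\<pi>:]"
  define I where "I = radical_quotient_ideal e \<pi>"
  have I: "h \<in> I \<longleftrightarrow> g dvd h" for h
    by (auto simp: I_def g_def radical_quotient_ideal_def cgenideal_def ring_of_type_algebra_def
        dvd_def mult.commute)
  interpret P: cring "rng :: 'a poly ring" by (rule cring_from_type_algebra)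
  have ideal: "ideal I (rng :: 'a poly ring)"
    unfolding I_def radical_quotient_ideal_def
    by (rule P.cgenideal_ideal) (simp add: ring_of_type_algebra_def)
  define ev where "ev h = \<psi> (I +>\<^bsub>rng\<^esub> h)" for h
  have coset_hom: "(+>\<^bsub>rng\<^esub>) I \<in> ring_hom rng (rng Quot I)"
    by (rule ideal.rcos_ring_hom[OF ideal])
  have \<psi>_hom: "\<psi> \<in> ring_hom (rng Quot I) rng" and \<psi>_bij: "bij_betw \<psi> (carrier (rng Quot I)) UNIV"
    using \<psi> by (simp_all add: ring_iso_def I_def ring_of_type_algebra_def)
  have "\<psi> \<circ> (+>\<^bsub>rng\<^esub>) I \<in> ring_hom rng rng"
    by (rule ring_hom_trans[OF coset_hom \<psi>_hom])
  then have ev: "ev (h + k) = ev h + ev k" "ev (h * k) = ev h * ev k" "ev 1 = 1" for h k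
    unfolding ring_hom_def by (simp_all add: ring_of_type_algebra_def ev_def)
  have j: "ev [:a:] = j a" for a using base by (simp add: ev_def I_def)
  have j_hom: "field_hom j"
  proof
    show "j 1 = 1" using j[of 1] ev(3) by (simp flip: one_pCons)
    show "j (a + b) = j a + j b" for a b using ev(1)[of "[:a:]" "[:b:]"] by (simp add: j)
    show "j (a * b) = j a * j b" for a b using ev(2)[of "[:a:]" "[:b:]"] by (simp add: j mult.commute)
  qed
  interpret j: field_hom j by (rule j_hom)
  define \<theta> where "\<theta> = ev [:0, 1:]"
  have ev_poly: "ev h = poly (map_poly j h) \<theta>" for h
  proof (induction h)
    case 0
    show ?case using j[of 0] by simp
  next
    case (pCons a h)
    have "pCons a h = [:a:] + [:0, 1:] * h" by simp
    then have "ev (pCons a h) = j a + \<theta> * ev h"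
      using ev j \<theta>_def by metis
    then show ?case using pCons by (simp add: map_poly_pCons)
  qed
  have cosets: "carrier (rng Quot I) = range ((+>\<^bsub>rng\<^esub>) I)"
    by (auto simp: FactRing_def A_RCOSETS_def' ring_of_type_algebra_def)
  have "simple_ext j \<theta> g"
  proof unfold_locales
    fix x
    have "x \<in> \<psi> ` range ((+>\<^bsub>rng\<^esub>) I)"
      using \<psi>_bij by (simp add: bij_betw_def cosets)
    then obtain h where "x = ev h" by (auto simp: ev_def)
    then show "\<exists>h. x = poly (map_poly j h) \<theta>" using ev_poly by blast
  next
    fix h
    have mem: "y \<in> I +>\<^bsub>rng\<^esub> h \<longleftrightarrow> g dvd y - h" for y h
    proof -
      have "y \<in> I +>\<^bsub>rng\<^esub> h \<longleftrightarrow> (\<exists>k\<in>I. y = k + h)"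
        by (simp add: a_r_coset_def' ring_of_type_algebra_def)
      also have "\<dots> \<longleftrightarrow> y - h \<in> I" by (auto intro!: bexI[of _ "y - h"])
      finally show ?thesis by (simp add: I)
    qed
    have "ev h = 0 \<longleftrightarrow> ev h = ev 0" using j[of 0] by simp
    also have "\<dots> \<longleftrightarrow> I +>\<^bsub>rng\<^esub> h = I +>\<^bsub>rng\<^esub> 0"
      unfolding ev_def using \<psi>_bij by (auto simp: bij_betw_def cosets inj_on_def)
    also have "\<dots> \<longleftrightarrow> g dvd h"
    proof
      assume "I +>\<^bsub>rng\<^esub> h = I +>\<^bsub>rng\<^esub> 0"
      then show "g dvd h" using mem[of h h] mem[of h 0] by simp
    next
      assume "g dvd h"
      then have "g dvd y - h \<longleftrightarrow> g dvd y" for y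
        by (metis dvd_diff dvd_add diff_add_cancel)
      then show "I +>\<^bsub>rng\<^esub> h = I +>\<^bsub>rng\<^esub> 0" using mem[of _ 0] by (auto simp: mem)
    qed
    finally show "poly (map_poly j h) \<theta> = 0 \<longleftrightarrow> g dvd h" by (simp add: ev_poly)
  next
    show "g \<noteq> 0" unfolding g_def by (rule radical_neq_0[OF assms(2)])
  qed
  then show ?thesis using \<pi> unfolding g_def by blast
qed

section \<open>Integral elements, one-units and roots in the radical extension\<close>

locale ramified_radical = valued_field w + simple_ext j \<theta> "Polynomial.monom 1 e - [:\<pi>:]"
  for w :: "'m::field \<Rightarrow> int" and j :: "'m \<Rightarrow> 'l::field" and \<theta> e \<pi> +
  assumes e_pos: "e > 0" and uniformiser: "\<pi> \<noteq> 0" "w \<pi> = 1"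
begin

text \<open>The polynomials in \<theta> with integral coefficients. As T^e - \<pi> is Eisenstein,
  this is the valuation ring of L, and \<open>\<MM>\<close> below is its maximal ideal, both
  described without a valuation on L.\<close>

definition \<O> :: "'l set"
  where "\<O> = {poly (map_poly j h) \<theta> | h. \<forall>k. val_ge w 0 (coeff h k)}"

definition \<MM> :: "'l set"
  where "\<MM> = {poly (map_poly j h) \<theta> | h. (\<forall>k. val_ge w 0 (coeff h k)) \<and> val_ge w 1 (coeff h 0)}"

lemma \<theta>_power: "\<theta> ^ e = j \<pi>"
  using g_root by (simp add: map_poly_radical poly_monom)

lemma \<theta>_neq_0: "\<theta> \<noteq> 0"
  using \<theta>_power e_pos uniformiser by (auto simp: power_0_left)

lemma \<MM>_subset_\<O>: "\<MM> \<subseteq> \<O>"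
  by (auto simp: \<O>_def \<MM>_def)

lemma \<MM>_add: "x \<in> \<MM> \<Longrightarrow> y \<in> \<MM> \<Longrightarrow> x + y \<in> \<MM>"
  unfolding \<MM>_def
proof clarify
  fix h k assume "\<forall>n. val_ge w 0 (coeff h n)" "val_ge w 1 (coeff h 0)"
    "\<forall>n. val_ge w 0 (coeff k n)" "val_ge w 1 (coeff k 0)"
  then show "\<exists>r. poly (map_poly j h) \<theta> + poly (map_poly j k) \<theta> = poly (map_poly j r) \<theta> \<and>
      (\<forall>n. val_ge w 0 (coeff r n)) \<and> val_ge w 1 (coeff r 0)"
    by (intro exI[of _ "h + k"]) (simp add: map_poly_add val_ge_add)
qed

lemma \<O>_add: "x \<in> \<O> \<Longrightarrow> y \<in> \<O> \<Longrightarrow> x + y \<in> \<O>"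
  unfolding \<O>_def
proof clarify
  fix h k assume "\<forall>n. val_ge w 0 (coeff h n)" "\<forall>n. val_ge w 0 (coeff k n)"
  then show "\<exists>r. poly (map_poly j h) \<theta> + poly (map_poly j k) \<theta> = poly (map_poly j r) \<theta> \<and>
      (\<forall>n. val_ge w 0 (coeff r n))"
    by (intro exI[of _ "h + k"]) (simp add: map_poly_add val_ge_add)
qed

lemma \<MM>_mult: "x \<in> \<MM> \<Longrightarrow> y \<in> \<O> \<Longrightarrow> x * y \<in> \<MM>"
  unfolding \<MM>_def \<O>_def
proof clarify
  fix h k assume "\<forall>n. val_ge w 0 (coeff h n)" "val_ge w 1 (coeff h 0)"
    "\<forall>n. val_ge w 0 (coeff k n)"
  then show "\<exists>r. poly (map_poly j h) \<theta> * poly (map_poly j k) \<theta> = poly (map_poly j r) \<theta> \<and>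
      (\<forall>n. val_ge w 0 (coeff r n)) \<and> val_ge w 1 (coeff r 0)"
    by (intro exI[of _ "h * k"]) (simp add: map_poly_mult coeff_mult val_ge_sum val_ge_mult0)
qed

lemma base_in_\<MM>: "val_ge w 1 a \<Longrightarrow> j a \<in> \<MM>"
  unfolding \<MM>_def using val_ge_mono[of 1 a 0]
  by (auto intro!: exI[of _ "[:a:]"] simp: map_poly_const coeff_pCons split: nat.split)

lemma monomial_in_\<MM>: "val_ge w 0 a \<Longrightarrow> n > 0 \<Longrightarrow> j a * \<theta> ^ n \<in> \<MM>"
  unfolding \<MM>_def
  by (auto intro!: exI[of _ "Polynomial.monom a n"] simp: map_poly_monom poly_monom)

lemma one_in_\<O>: "1 \<in> \<O>"
  unfolding \<O>_def by (auto intro!: exI[of _ 1] simp: coeff_1)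

lemma \<MM>_sum: "(\<And>a. a \<in> A \<Longrightarrow> h a \<in> \<MM>) \<Longrightarrow> sum h A \<in> \<MM>"
  using base_in_\<MM>[of 0]
  by (induction A rule: infinite_finite_induct) (simp_all add: \<MM>_add)

text \<open>Brings congruences in L back to K_f. If h(\<theta>) = j a, then h - a = (T^e - \<pi>) r,
  and the constant coefficients give a = h_0 + \<pi> r_0; so integrality of \<open>r\<close>
  suffices.\<close>

lemma \<MM>_base:
  assumes "j a \<in> \<MM>"
  shows "val_ge w 1 a"
proof -
  obtain h where h: "j a = poly (map_poly j h) \<theta>" "\<And>k. val_ge w 0 (coeff h k)" "val_ge w 1 (coeff h 0)"
    using assms by (auto simp: \<MM>_def)
  have "poly (map_poly j (h - [:a:])) \<theta> = 0"
    using h(1) by (simp add: map_poly_diff map_poly_const)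
  then obtain r where r: "h - [:a:] = (Polynomial.monom 1 e - [:\<pi>:]) * r"
    using kernel by (auto elim!: dvdE)
  have r_coeff: "coeff (h - [:a:]) n = (if e \<le> n then coeff r (n - e) else 0) - \<pi> * coeff r n" for n
  proof -
    have "(Polynomial.monom 1 e - [:\<pi>:]) * r = Polynomial.monom 1 e * r - smult \<pi> r"
      by (simp add: left_diff_distrib del: diff_pCons)
    then show ?thesis unfolding r by (simp add: coeff_monom_mult del: diff_pCons)
  qed
  have v\<pi>: "val_ge w 1 \<pi>" "val_ge w 0 \<pi>" using uniformiser by (simp_all add: val_ge_def)
  text \<open>The divisor is monic, so the coefficients of \<open>r\<close> are integral from the top degree downwards.\<close>
  have "val_ge w 0 (coeff r m)" for m
  proof (induction "degree r - m" arbitrary: m rule: less_induct)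
    case less
    show ?case
    proof (cases "m > degree r")
      case True
      then show ?thesis by (simp add: coeff_eq_0)
    next
      case False
      have "val_ge w 0 (coeff r (m + e))"
      proof (cases "m + e > degree r")
        case True
        then show ?thesis by (simp add: coeff_eq_0)
      qed (use less[of "m + e"] e_pos False in simp)
      moreover have "coeff r m = coeff h (m + e) + \<pi> * coeff r (m + e)"
        using r_coeff[of "m + e"] e_pos by (simp add: coeff_pCons split: nat.splits)
      ultimately show ?thesis using h(2) v\<pi>(2) by (simp add: val_ge_add val_ge_mult0)
    qed
  qed
  then have "val_ge w 1 (coeff h 0 + \<pi> * coeff r 0)"
    using h(3) v\<pi>(1) by (intro val_ge_add val_ge_mult0)
  moreover have "a = coeff h 0 - coeff (h - [:a:]) 0" by simp
  then have "a = coeff h 0 + \<pi> * coeff r 0"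
    unfolding r_coeff using e_pos by simp
  ultimately show ?thesis by simp
qed

lemma one_unit_in_\<O>: "x - 1 \<in> \<MM> \<Longrightarrow> x \<in> \<O>"
  using \<O>_add[of "x - 1" 1] \<MM>_subset_\<O> one_in_\<O> by auto

lemma one_unit_mult:
  assumes "x - 1 \<in> \<MM>" "y - 1 \<in> \<MM>"
  shows "x * y - 1 \<in> \<MM>"
proof -
  have "(x - 1) * y + (y - 1) \<in> \<MM>"
    using assms by (intro \<MM>_add \<MM>_mult one_unit_in_\<O>)
  then show ?thesis by (simp add: algebra_simps)
qed

lemma one_unit_power: "x - 1 \<in> \<MM> \<Longrightarrow> x ^ n - 1 \<in> \<MM>"
  using base_in_\<MM>[of 0] by (induction n) (simp_all add: one_unit_mult)

text \<open>Choosing the index of the monomial of least valuation in \<open>\<Sum>\<^sub>l a\<^sub>l \<theta>\<^sup>l\<close> isolates the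
  leading term.  This replaces the construction of the valuation of the extension.\<close>

lemma decomposition:
  assumes "x \<noteq> 0"
  shows "\<exists>c k u. c \<noteq> 0 \<and> k < e \<and> u - 1 \<in> \<MM> \<and> x = j c * \<theta> ^ k * u"
proof -
  obtain a where a: "x = (\<Sum>k<e. j (a k) * \<theta> ^ k)"
    using power_basis[of x] e_pos by (auto simp: degree_radical)
  define A where "A = {k. k < e \<and> a k \<noteq> 0}"
  \<comment> \<open>The valuation of the k-th monomial when \<theta> has valuation 1. For k < e
    these numbers are incongruent modulo e, so the least one is attained once.\<close>
  define \<phi> where "\<phi> k = int e * w (a k) + int k" for k
  have "A \<noteq> {}"
  proof
    assume "A = {}"
    then have "\<And>k. k < e \<Longrightarrow> a k = 0" by (auto simp: A_def)
    then show False using assms a by simp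
  qed
  moreover have fin: "finite A" by (simp add: A_def)
  ultimately have "Min (\<phi> ` A) \<in> \<phi> ` A" by (intro Min_in) auto
  then obtain k where k: "k \<in> A" "\<phi> k = Min (\<phi> ` A)" by auto
  have least: "\<phi> k \<le> \<phi> l" if "l \<in> A" for l
    unfolding k(2) using that fin by (intro Min_le) auto
  have ck: "a k \<noteq> 0" "k < e" using k(1) by (simp_all add: A_def)
  define u where "u = x / (j (a k) * \<theta> ^ k)"
  have summand: "j (a l) * \<theta> ^ l / (j (a k) * \<theta> ^ k) \<in> \<MM>" if l: "l < e" "l \<noteq> k" for l
  proof (cases "a l = 0")
    case True
    then show ?thesis using base_in_\<MM>[of 0] by simp
  next
    case False
    note al = this
    then have "\<phi> k \<le> \<phi> l" using l least by (simp add: A_def)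
    then have le: "int k - int l \<le> int e * (w (a l) - w (a k))"
      by (simp add: \<phi>_def algebra_simps)
    show ?thesis
    proof (cases "l > k")
      case True
      have "w (a l) - w (a k) \<ge> 0"
      proof (rule ccontr)
        assume "\<not> w (a l) - w (a k) \<ge> 0"
        then have "int e * (w (a l) - w (a k)) \<le> int e * (- 1)"
          by (intro mult_left_mono) auto
        then show False using le l(1) by linarith
      qed
      then have "val_ge w 0 (a l / a k)"
        using ck al by (simp add: val_ge_def val_divide)
      then have "j (a l / a k) * \<theta> ^ (l - k) \<in> \<MM>"
        using True by (intro monomial_in_\<MM>) simp_all
      also have "j (a l / a k) * \<theta> ^ (l - k) = j (a l) * \<theta> ^ l / (j (a k) * \<theta> ^ k)"
        using True \<theta>_neq_0 by (simp add: hom_divide power_diff)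
      finally show ?thesis .
    next
      case False
      then have lk: "l < k" using l by simp
      have "w (a l) - w (a k) \<ge> 1"
      proof (rule ccontr)
        assume "\<not> w (a l) - w (a k) \<ge> 1"
        then have "int e * (w (a l) - w (a k)) \<le> int e * 0"
          by (intro mult_left_mono) auto
        then show False using le lk by simp
      qed
      \<comment> \<open>Here l < k, and the coefficient quotient has a factor \<pi> to spare.
        Trading it for \<theta>^e gives the exponent e + l - k, positive because k < e.\<close>
      then have "val_ge w 0 (a l / (a k * \<pi>))"
        using ck al uniformiser by (simp add: val_ge_def val_divide val_mult)
      then have "j (a l / (a k * \<pi>)) * \<theta> ^ (e + l - k) \<in> \<MM>"
        using ck by (intro monomial_in_\<MM>) simp_all
      also have "j (a l / (a k * \<pi>)) * \<theta> ^ (e + l - k) = j (a l) * \<theta> ^ l / (j (a k) * \<theta> ^ k)"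
      proof -
        have "\<theta> ^ (e + l - k) = j \<pi> * \<theta> ^ l / \<theta> ^ k"
          using ck \<theta>_neq_0 by (simp add: power_diff power_add \<theta>_power)
        then show ?thesis using uniformiser by (simp add: hom_divide hom_mult)
      qed
      finally show ?thesis .
    qed
  qed
  have nz: "j (a k) * \<theta> ^ k \<noteq> 0" using ck \<theta>_neq_0 by simp
  have "x = j (a k) * \<theta> ^ k + (\<Sum>l\<in>{..<e} - {k}. j (a l) * \<theta> ^ l)"
    unfolding a by (rule sum.remove) (use ck in auto)
  then have "u = (j (a k) * \<theta> ^ k + (\<Sum>l\<in>{..<e} - {k}. j (a l) * \<theta> ^ l)) / (j (a k) * \<theta> ^ k)"
    by (simp only: u_def)
  then have "u - 1 = (\<Sum>l\<in>{..<e} - {k}. j (a l) * \<theta> ^ l / (j (a k) * \<theta> ^ k))"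
    using nz by (simp add: add_divide_distrib sum_divide_distrib)
  also have "\<dots> \<in> \<MM>" by (rule \<MM>_sum) (use summand in auto)
  finally have "u - 1 \<in> \<MM>" .
  moreover have "x = j (a k) * \<theta> ^ k * u" using nz by (simp add: u_def)
  ultimately show ?thesis using ck by blast
qed

text \<open>Raise s = j c \<theta>^k u to the power e. The factor u^e equals \<open>j d\<close> with
  d = b / (c^e \<pi>^k), and a one-unit of L coming from K_f is a one-unit there by
  \<open>\<MM>_base\<close>.\<close>

lemma root_decomposition:
  assumes "s ^ e = j b" "b \<noteq> 0"
  shows "\<exists>c k u d. c \<noteq> 0 \<and> k < e \<and> u - 1 \<in> \<MM> \<and> s = j c * \<theta> ^ k * u \<and>
    b = c ^ e * \<pi> ^ k * d \<and> d \<approx> 1"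
proof -
  have "s \<noteq> 0" using assms e_pos by (auto simp: power_0_left)
  then obtain c k u where s: "c \<noteq> 0" "k < e" "u - 1 \<in> \<MM>" "s = j c * \<theta> ^ k * u"
    using decomposition by blast
  define d where "d = b / (c ^ e * \<pi> ^ k)"
  have b: "b = c ^ e * \<pi> ^ k * d" using s(1) uniformiser by (simp add: d_def)
  have "(\<theta> ^ k) ^ e = (\<theta> ^ e) ^ k" by (simp add: mult.commute flip: power_mult)
  then have "j b = j (c ^ e * \<pi> ^ k) * u ^ e"
    using assms(1) s(4) by (simp add: power_mult_distrib hom_mult hom_power \<theta>_power)
  then have "j d = u ^ e"
    using s(1) uniformiser by (simp add: d_def hom_divide)
  then have "j (d - 1) \<in> \<MM>" using one_unit_power[OF s(3), of e] by (simp add: hom_diff)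
  then have "d \<approx> 1" by (rule \<MM>_base)
  then show ?thesis using s b by blast
qed

text \<open>If x differs from 1, then 1 + x + ... + x^(e-1) = 0; but this sum is congruent to e,
  which is a unit.\<close>

lemma one_unit_root_of_unity:
  assumes "\<not> val_ge w 1 (of_nat e)" "x ^ e = 1" "x - 1 \<in> \<MM>"
  shows "x = 1"
proof (rule ccontr)
  assume "x \<noteq> 1"
  have "(x - 1) * (\<Sum>k<e. x ^ k) = x ^ e - 1" by (rule power_diff_1_eq[symmetric])
  then have S: "(\<Sum>k<e. x ^ k) = 0" using \<open>x \<noteq> 1\<close> assms(2) by simp
  have "(\<Sum>k<e. x ^ k - 1) \<in> \<MM>" using one_unit_power[OF assms(3)] by (intro \<MM>_sum)
  also have "(\<Sum>k<e. x ^ k - 1) = j (- of_nat e)"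
    using S by (simp add: sum_subtractf hom_uminus)
  finally have "val_ge w 1 (- of_nat e)" by (rule \<MM>_base)
  then show False using assms(1) by simp
qed

text \<open>Valuations in 1 = c^e \<pi>^k d force k = 0 and w c = 0. So x is congruent to a unit of
  K_f and x^n to 1; being a one-unit with e-th power 1, x^n equals 1. Applied with n = N.\<close>

lemma root_of_unity_power:
  fixes x :: 'l
  assumes e: "\<not> val_ge w 1 (of_nat e)"
    and n: "\<And>c. c \<noteq> 0 \<Longrightarrow> w c = 0 \<Longrightarrow> c ^ n \<approx> 1"
    and x: "x ^ e = 1"
  shows "x ^ n = 1"
proof -
  have "x ^ e = j 1" using x by simp
  then obtain c k u d where c: "c \<noteq> 0" "k < e" "u - 1 \<in> \<MM>" "x = j c * \<theta> ^ k * u"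
      "1 = c ^ e * \<pi> ^ k * d" "d \<approx> 1"
    using root_decomposition[of x 1] by auto
  have d: "d \<noteq> 0" "w d = 0" using cong_1_unit[OF c(6)] .
  have "w (c ^ e * \<pi> ^ k * d) = int e * w c + int k"
    using c(1) d uniformiser by (simp add: val_mult val_power)
  then have 0: "int e * w c + int k = 0" using c(5) by simp
  then have "int e dvd int k"
    by (metis dvd_add_right_iff dvd_triv_left dvd_0_right)
  then have "k = 0" using c(2) by (auto dest: zdvd_imp_le)
  then have "w c = 0" using 0 e_pos by simp
  then have "j (c ^ n) - 1 \<in> \<MM>"
    using base_in_\<MM>[OF n[OF c(1)]] by (simp add: hom_diff)
  then have "j (c ^ n) * u ^ n - 1 \<in> \<MM>"
    using one_unit_power[OF c(3)] by (rule one_unit_mult)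
  then have "x ^ n - 1 \<in> \<MM>"
    using c(4) \<open>k = 0\<close> by (simp add: power_mult_distrib hom_power)
  moreover have "(x ^ n) ^ e = 1" using x by (metis mult.commute power_mult power_one)
  ultimately show ?thesis using one_unit_root_of_unity[OF e] by blast
qed

end

text \<open>The product of T - y over the distinct conjugates y of x is permuted into itself by the
  automorphisms, so its coefficients lie in the fixed field, which is the base.\<close>

lemma conjugate_polynomial:
  assumes "galois_extension k"
  shows "\<exists>p. p \<noteq> 0 \<and> poly (map_poly k p) x = 0 \<and>
    card {y. poly (map_poly k p) y = 0} = degree p"
proof -
  interpret k: field_hom k
    using assms by (simp add: galois_extension_def algebraic_extension_def field_embedding_iff)
  let ?G = "carrier (galois_group k)"
  define Z where "Z = (\<lambda>\<sigma>. \<sigma> x) ` ?G"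
  obtain p0 where p0: "p0 \<noteq> 0" "poly (map_poly k p0) x = 0"
    using assms unfolding galois_extension_def algebraic_extension_def by blast
  \<comment> \<open>Conjugates are roots of one polynomial over the base, so they are finite in
    number even if the group is infinite.\<close>
  have "Z \<subseteq> {y. poly (map_poly k p0) y = 0}"
  proof
    fix y assume "y \<in> Z"
    then obtain \<sigma> where \<sigma>: "field_hom \<sigma>" "\<And>a. \<sigma> (k a) = k a" "y = \<sigma> x"
      by (auto simp: Z_def galois_group_carrier)
    have "map_poly \<sigma> (map_poly k p0) = map_poly k p0"
      using field_hom_map_comp[OF k.field_hom_axioms \<sigma>(1)] \<sigma>(2) by (simp add: comp_def)
    then have "poly (map_poly k p0) y = \<sigma> (poly (map_poly k p0) x)"
      using \<sigma>(3) field_hom.hom_poly[OF \<sigma>(1)] by metis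
    then show "y \<in> {y. poly (map_poly k p0) y = 0}"
      using p0 field_hom.hom_zero[OF \<sigma>(1)] by simp
  qed
  then have fin: "finite Z"
    using p0 k.map_poly_eq_0 poly_roots_finite finite_subset by blast
  define P where "P = (\<Prod>y\<in>Z. [:- y, 1:])"
  have P_root: "poly P y = 0 \<longleftrightarrow> y \<in> Z" for y
    using fin by (auto simp: P_def poly_prod)
  have "P \<noteq> 0" using fin by (simp add: P_def)
  have deg: "degree P = card Z"
    unfolding P_def by (subst degree_prod_eq_sum_degree) simp_all
  have fixed: "map_poly \<tau> P = P" if \<tau>: "\<tau> \<in> ?G" for \<tau>
  proof -
    interpret t: field_hom \<tau> using \<tau> by (simp add: galois_group_carrier)
    have "\<tau> ` Z \<subseteq> Z"
    proof
      fix y assume "y \<in> \<tau> ` Z"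
      then obtain \<sigma> where \<sigma>: "\<sigma> \<in> ?G" "y = (\<tau> \<circ> \<sigma>) x" by (auto simp: Z_def)
      have "\<tau> \<circ> \<sigma> \<in> ?G"
        using \<sigma>(1) \<tau> unfolding galois_group_carrier
        by (simp add: field_hom_compose comp_surj[of \<sigma> \<tau>] del: o_apply) simp
      then show "y \<in> Z" using \<sigma>(2) unfolding Z_def by blast
    qed
    then have Z: "\<tau> ` Z = Z"
      using fin t.hom_inj inj_on_subset[OF t.hom_inj, of Z] by (intro endo_inj_surj) auto
    have "map_poly \<tau> (\<Prod>y\<in>A. [:- y, 1:]) = (\<Prod>y\<in>A. [:- \<tau> y, 1:])" for A
      by (induction A rule: infinite_finite_induct)
        (simp_all add: t.map_poly_mult map_poly_pCons t.hom_uminus del: mult_pCons_left)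
    then have "map_poly \<tau> P = (\<Prod>y\<in>\<tau> ` Z. [:- y, 1:])"
      by (simp add: P_def prod.reindex[OF inj_on_subset[OF t.hom_inj]])
    then show ?thesis by (simp add: Z P_def)
  qed
  have "coeff P n \<in> range k" for n
  proof -
    have "\<tau> (coeff P n) = coeff P n" if \<tau>: "\<tau> \<in> ?G" for \<tau>
    proof -
      interpret t: field_hom \<tau> using \<tau> by (simp add: galois_group_carrier)
      show ?thesis using fixed[OF \<tau>] t.coeff_map by metis
    qed
    then show ?thesis using assms unfolding galois_extension_def by blast
  qed
  then have inv: "k (inv_into UNIV k (coeff P n)) = coeff P n" for n
    by (simp add: f_inv_into_f)
  \<comment> \<open>Needed for \<open>map_poly\<close> to act coefficientwise when the product is
    pulled back to the base.\<close>
  have "inv_into UNIV k 0 = 0" using inv_into_f_f[OF k.hom_inj, of 0] by simp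
  then have P: "map_poly k (map_poly (inv_into UNIV k) P) = P"
    by (simp add: poly_eq_iff coeff_map_poly inv)
  have "id \<in> ?G" by (simp add: galois_group_carrier field_hom_id)
  then have "x \<in> Z" unfolding Z_def by (intro image_eqI[of _ _ id]) simp_all
  then have "poly P x = 0" using P_root by simp
  moreover have "card {y. poly P y = 0} = degree P" using P_root deg by simp
  moreover have "degree (map_poly (inv_into UNIV k) P) = degree P"
    using k.degree_map[of "map_poly (inv_into UNIV k) P"] P by simp
  moreover have "map_poly (inv_into UNIV k) P \<noteq> 0" using P \<open>P \<noteq> 0\<close> by auto
  ultimately show ?thesis
    using P by (intro exI[of _ "map_poly (inv_into UNIV k) P"]) simp
qed


text \<open>The products of powers \<zeta>^l \<theta>^k from the two layers form a finite spanning
  set of L over K.\<close>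

lemma unramified_radical_algebraic:
  assumes "unramified v w i f" and "ramified_radical w j \<theta> e \<pi>"
  shows "\<exists>p. p \<noteq> 0 \<and> poly (map_poly (j \<circ> i) p) x = 0"
proof -
  interpret U: unramified v w i f by fact
  interpret R: ramified_radical w j \<theta> e \<pi> by fact
  interpret ji: field_hom "j \<circ> i"
    by (rule field_hom_compose[OF U.field_hom_axioms R.field_hom_axioms])
  obtain \<zeta> g where "simple_ext i \<zeta> g" using U.primitive_element by blast
  then interpret Z: simple_ext i \<zeta> g .
  let ?b = "\<lambda>kl. j (\<zeta> ^ snd kl) * \<theta> ^ fst kl"
  have "\<exists>c. y = (\<Sum>kl\<in>{..<e} \<times> {..<degree g}. (j \<circ> i) (c kl) * ?b kl)" for y
  proof -
    obtain a where a: "y = (\<Sum>k<e. j (a k) * \<theta> ^ k)"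
      using R.power_basis[of y] R.e_pos by (auto simp: degree_radical)
    have "\<exists>c. \<forall>k. a k = (\<Sum>l<degree g. i (c k l) * \<zeta> ^ l)"
      by (rule choice, rule allI, rule Z.power_basis)
    then obtain c where c: "\<And>k. a k = (\<Sum>l<degree g. i (c k l) * \<zeta> ^ l)" by blast
    have "y = (\<Sum>k<e. \<Sum>l<degree g. j (i (c k l)) * (j (\<zeta> ^ l) * \<theta> ^ k))"
      unfolding a c by (simp add: R.hom_sum R.hom_mult sum_distrib_right mult.assoc)
    also have "\<dots> = (\<Sum>kl\<in>{..<e} \<times> {..<degree g}. (j \<circ> i) (c (fst kl) (snd kl)) * ?b kl)"
      by (simp add: sum.cartesian_product case_prod_unfold)
    finally show ?thesis by (rule exI[of _ "\<lambda>kl. c (fst kl) (snd kl)"])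
  qed
  then show ?thesis
    by (rule ji.finite_span_algebraic[rotated]) simp
qed

lemma card_scaled_roots_of_unity:
  fixes \<theta> :: "'a::field"
  assumes "\<theta> \<noteq> 0"
  shows "card {y. y ^ e = \<theta> ^ e} = card {z::'a. z ^ e = 1}"
proof -
  have "{y. y ^ e = \<theta> ^ e} = (\<lambda>z. z * \<theta>) ` {z. z ^ e = 1}"
  proof
    show "{y. y ^ e = \<theta> ^ e} \<subseteq> (\<lambda>z. z * \<theta>) ` {z. z ^ e = 1}"
      using assms by (auto intro!: image_eqI[of _ _ "_ / \<theta>"] simp: power_divide)
  qed (auto simp: power_mult_distrib)
  moreover have "inj_on (\<lambda>z. z * \<theta>) {z. z ^ e = 1}" using assms by (auto simp: inj_on_def)
  ultimately show ?thesis using card_image by metis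
qed

theorem corollary7p1p3:
  fixes v :: "'k::field \<Rightarrow> int" and w :: "'m::field \<Rightarrow> int"
    and i :: "'k \<Rightarrow> 'm" and j :: "'m \<Rightarrow> 'l::field"
    and D :: "'m set set" and p q e f :: nat
  assumes "local_field v"
    and "p = ring_char (residue_field v)"
    and "q = card (carrier (residue_field v))"
    and "e > 0" and "\<not> [e = 0] (mod p)"
    and "f > 0"
    and "unramified_extension v w i f"
    and "ramified_line e w D"
    and "radical_extension e w D j"
  shows "galois_extension (j \<circ> i) \<longleftrightarrow>
    orbit (galois_group i) line_action D = {D} \<and> [q ^ f = 1] (mod e)"
proof -
  have unram: "unramified v w i f"
    using assms by unfold_locales
  interpret U: unramified v w i f by (rule unram)
  obtain \<pi> \<theta> where \<pi>: "\<pi> \<noteq> 0" "w \<pi> = 1" "power_class e \<pi> \<in> D"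
    and "simple_ext j \<theta> (Polynomial.monom 1 e - [:\<pi>:])"
    using radical_extension_simple[OF assms(9,4)] by blast
  then have radical: "ramified_radical w j \<theta> e \<pi>"
    using U.W.valued_field_axioms assms(4)
    by (simp add: ramified_radical_def ramified_radical_axioms_def)
  interpret R: ramified_radical w j \<theta> e \<pi> by (rule radical)
  interpret ji: field_hom "j \<circ> i"
    by (rule field_hom_compose[OF U.field_hom_axioms R.field_hom_axioms])
  note algebraic = unramified_radical_algebraic[OF unram radical]
  \<comment> \<open>p does not divide e, so e is a unit in K; the embedding preserves valuations, so
    it is one in K_f.\<close>
  have e_unit: "\<not> val_ge w 1 (of_nat e)"
    using assms(2,5) U.V.of_nat_residue[of e] U.val_embedding[of 1 "of_nat e"]
    by (simp add: cong_0_iff)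
  \<comment> \<open>Makes the natural-number subtraction in \<open>N\<close> exact.\<close>
  have "q ^ f \<ge> 1" using U.N_pos assms(3) by (simp add: U.N_def)
  then have cong: "[q ^ f = 1] (mod e) \<longleftrightarrow> e dvd U.N"
    using cong_altdef_nat[of 1 "q ^ f" e] by (simp add: U.N_def assms(3))
  have in_galois: "\<sigma> \<in> carrier (galois_group (j \<circ> i))"
    if "field_hom \<sigma>" "\<And>a. \<sigma> (j (i a)) = j (i a)" for \<sigma>
    unfolding galois_group_carrier
    using that algebraic_endomorphism_surj[OF ji.field_hom_axioms that(1) algebraic] by simp
  show ?thesis unfolding orbit_singleton_iff cong
  proof

    \<comment> \<open>Necessity: the orbit and divisibility conditions from a Galois
      extension\<close>
    assume galois: "galois_extension (j \<circ> i)"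
    obtain P where P: "P \<noteq> 0" "poly (map_poly (j \<circ> i) P) \<theta> = 0"
        "card {y. poly (map_poly (j \<circ> i) P) y = 0} = degree P"
      using conjugate_polynomial[OF galois] by blast
    have P_ji: "map_poly (j \<circ> i) P = map_poly j (map_poly i P)"
      by (rule field_hom_map_comp[OF U.field_hom_axioms R.field_hom_axioms, symmetric])
    have dvd: "Polynomial.monom 1 e - [:\<pi>:] dvd map_poly i P"
      using P(2) unfolding P_ji by (simp only: R.kernel)
    \<comment> \<open>P has coefficients in K, which \<tau> fixes, so T^e - \<tau> \<pi> divides it
      along with T^e - \<pi> and inherits its distinct roots in L. An element \<tau> of G_f gives a
      root of \<sigma> \<pi>; the identity gives the roots of unity.\<close>
    have card_conj: "card {y. y ^ e = j (\<tau> \<pi>)} = e"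
      if \<tau>: "field_hom \<tau>" "\<And>a. \<tau> (i a) = i a" for \<tau>
    proof -
      interpret t: field_hom \<tau> by fact
      have "map_poly \<tau> (map_poly i P) = map_poly i P"
        using field_hom_map_comp[OF U.field_hom_axioms \<tau>(1)] \<tau>(2) by (simp add: comp_def)
      then have "Polynomial.monom 1 e - [:\<tau> \<pi>:] dvd map_poly i P"
        using t.map_poly_dvd[OF dvd] unfolding t.map_poly_radical by simp
      then have "Polynomial.monom 1 e - [:j (\<tau> \<pi>):] dvd map_poly (j \<circ> i) P" (is "?R dvd ?P")
        using R.map_poly_dvd unfolding P_ji R.map_poly_radical[symmetric] by blast
      moreover have "?P \<noteq> 0" using P(1) ji.map_poly_eq_0 by blast
      moreover have "card {y. poly ?P y = 0} = degree ?P"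
        using P(3) by (simp only: ji.degree_map)
      ultimately have "card {y. poly ?R y = 0} = degree ?R"
        using card_roots_dvd[of ?P ?R] by blast
      then show ?thesis
        unfolding degree_radical[OF assms(4)] by (simp only: poly_radical right_minus_eq)
    qed
    have stable: "line_action \<sigma> D = D" if \<sigma>: "\<sigma> \<in> carrier (galois_group i)" for \<sigma>
    proof -
      interpret s: field_hom \<sigma> using \<sigma> by (simp add: galois_group_carrier)
      have surj: "surj \<sigma>" and fix_base: "\<And>a. \<sigma> (i a) = i a"
        using \<sigma> by (simp_all add: galois_group_carrier)
      have \<sigma>\<pi>: "\<sigma> \<pi> \<noteq> 0" using \<pi> by simp
      have "card {y. y ^ e = j (\<sigma> \<pi>)} > 0"
        using card_conj[OF s.field_hom_axioms fix_base] assms(4) by simp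
      then obtain s where "s ^ e = j (\<sigma> \<pi>)"
        by (metis (mono_tags) card.empty equals0I less_numeral_extra(3) mem_Collect_eq)
      then obtain c k d where c: "c \<noteq> 0" "\<sigma> \<pi> = c ^ e * \<pi> ^ k * d" "val_ge w 1 (d - 1)"
        using R.root_decomposition[OF _ \<sigma>\<pi>] by blast
      \<comment> \<open>Hensel's lemma from the approximate root 1: the one-unit d is an e-th power,
        so \<sigma> \<pi> and \<pi>^k have the same class.\<close>
      have "\<exists>z. z ^ e = d \<and> val_ge w 1 (z - 1)"
        using c(3) by (intro U.W.hensel_radical U.complete e_unit) (simp_all add: U.W.val_ge_commute)
      then obtain z where z: "z ^ e = d" "z \<noteq> 0" using U.W.cong_1_unit by blast
      have "power_class e (\<sigma> \<pi>) = power_class e (\<pi> ^ k)"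
        by (rule power_class_eqI[of "c * z"]) (use c z in \<open>simp_all add: power_mult_distrib\<close>)
      then have "power_class e (\<sigma> \<pi>) \<in> D"
        using U.W.ramified_line_power[OF assms(8) \<pi>(3,1)] by simp
      then have pow: "power_class e (\<sigma> \<pi> ^ m) \<in> D" for m
        using U.W.ramified_line_power[OF assms(8) _ \<sigma>\<pi>] by blast
      have "\<sigma> ` C \<in> D" if "C \<in> D" for C
      proof -
        obtain m where "C = power_class e (\<pi> ^ m)"
          using U.W.ramified_line_generated[OF assms(8,4) \<pi>(3,1,2) \<open>C \<in> D\<close>] by blast
        then show ?thesis
          using image_power_class[OF s.field_hom_axioms surj] pow by (simp add: s.hom_power)
      qed
      \<comment> \<open>D is finite and \<sigma> acts injectively on it, so stability under
        inclusion gives equality.\<close>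
      then have "(`) \<sigma> ` D \<subseteq> D" by blast
      moreover have "inj_on ((`) \<sigma>) D"
        using s.hom_inj by (auto intro!: inj_onI simp: inj_image_eq_iff)
      ultimately show ?thesis
        unfolding line_action_def
        by (intro endo_inj_surj U.W.ramified_line_finite[OF assms(8,4)])
    qed
    have "card {y. y ^ e = \<theta> ^ e} = e"
      using card_conj[OF field_hom_id] by (simp add: R.\<theta>_power)
    then have mu_e: "card {z::'l. z ^ e = 1} = e"
      by (simp add: card_scaled_roots_of_unity[OF R.\<theta>_neq_0])
    \<comment> \<open>K_f already supplies N such roots through \<open>j\<close>, and the degree
      permits no more.\<close>
    have mu_N: "card {z::'l. z ^ U.N = 1} = U.N"
    proof (rule antisym)
      show "card {z::'l. z ^ U.N = 1} \<le> U.N" using card_roots_of_unity_le U.N_pos by blast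
      have "card (j ` {z. z ^ U.N = 1}) \<le> card {z::'l. z ^ U.N = 1}"
        by (intro card_mono card_roots_of_unity_le U.N_pos) (auto simp flip: R.hom_power)
      then show "U.N \<le> card {z::'l. z ^ U.N = 1}"
        using U.card_roots_N card_image[OF inj_on_subset[OF R.hom_inj]] by simp
    qed
    have "e dvd U.N"
      by (rule dvd_of_card_roots_of_unity[OF mu_e assms(4) mu_N U.N_pos])
        (rule R.root_of_unity_power[OF e_unit U.unit_pow_N])
    then show "(\<forall>\<sigma>\<in>carrier (galois_group i). line_action \<sigma> D = D) \<and> e dvd U.N"
      using stable by blast
  next

    \<comment> \<open>Sufficiency: descent of a fixed element from L to K_f and then to K\<close>
    assume "(\<forall>\<sigma>\<in>carrier (galois_group i). line_action \<sigma> D = D) \<and> e dvd U.N"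
    then have stable: "\<And>\<sigma>. \<sigma> \<in> carrier (galois_group i) \<Longrightarrow> line_action \<sigma> D = D"
      and "e dvd U.N" by auto
    then have mu_e: "card {z::'m. z ^ e = 1} = e"
      by (intro card_roots_of_unity_dvd[OF U.card_roots_N U.N_pos])
    have "{x. \<forall>\<sigma>\<in>carrier (galois_group (j \<circ> i)). \<sigma> x = x} \<subseteq> range (j \<circ> i)"
    proof
      fix x assume "x \<in> {x. \<forall>\<sigma>\<in>carrier (galois_group (j \<circ> i)). \<sigma> x = x}"
      then have fixed: "\<sigma> x = x" if "field_hom \<sigma>" "\<And>a. \<sigma> (j (i a)) = j (i a)" for \<sigma>
        using in_galois that by blast
      \<comment> \<open>The roots are the multiples of \<theta> by e-th roots of unity, and K_f
        contains e of these.\<close>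
      have split: "card {y. poly (map_poly j (Polynomial.monom 1 e - [:\<pi>:])) y = 0} =
          degree (Polynomial.monom 1 e - [:\<pi>:])"
      proof -
        have "card (j ` {z. z ^ e = 1}) \<le> card {z::'l. z ^ e = 1}"
          by (intro card_mono card_roots_of_unity_le assms(4)) (auto simp flip: R.hom_power)
        then have "card {z::'l. z ^ e = 1} = e"
          using mu_e card_image[OF inj_on_subset[OF R.hom_inj], of "{z. z ^ e = 1}"]
            card_roots_of_unity_le(2)[OF assms(4), where 'a='l] by simp
        then show ?thesis
          unfolding R.map_poly_radical degree_radical[OF assms(4)] poly_radical right_minus_eq
            R.\<theta>_power[symmetric] card_scaled_roots_of_unity[OF R.\<theta>_neq_0] .
      qed
      have "x \<in> range j"
        by (rule R.fixed_by_conjugations[OF split]) (rule fixed)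
      then obtain a where a: "x = j a" by blast
      \<comment> \<open>\<sigma> is lifted to an automorphism of L over K; since that fixes x = j a,
        \<sigma> fixes \<open>a\<close>.\<close>
      have "\<sigma> a = a" if \<sigma>: "\<sigma> \<in> carrier (galois_group i)" for \<sigma>
      proof -
        interpret s: field_hom \<sigma> using \<sigma> by (simp add: galois_group_carrier)
        have surj: "surj \<sigma>" and fix_base: "\<And>a. \<sigma> (i a) = i a"
          using \<sigma> by (simp_all add: galois_group_carrier)
        have "\<sigma> ` power_class e \<pi> \<in> D"
          using stable[OF \<sigma>] \<pi>(3) unfolding line_action_def by blast
        then have "power_class e (\<sigma> \<pi>) \<in> D"
          using image_power_class[OF s.field_hom_axioms surj] by simp
        \<comment> \<open>Both classes lie in D, and \<sigma> preserves the valuation, so they have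
          the same value in Z/e.\<close>
        then have "power_class e (\<sigma> \<pi>) = power_class e \<pi>"
          using U.W.ramified_line_inj[OF assms(8)] \<pi> U.galois_group_val[OF \<sigma> \<pi>(1)] by simp
        then obtain z where z: "\<sigma> \<pi> = z ^ e * \<pi>" using power_class_eqD by blast
        have j\<sigma>: "field_hom (j \<circ> \<sigma>)"
          by (rule field_hom_compose[OF s.field_hom_axioms R.field_hom_axioms])
        \<comment> \<open>(z \<theta>)^e = z^e \<pi> = \<sigma> \<pi>, so \<theta> may be sent to z
          \<theta> in extending \<sigma>.\<close>
        have "poly (map_poly (j \<circ> \<sigma>) (Polynomial.monom 1 e - [:\<pi>:])) (j z * \<theta>) = 0"
          unfolding field_hom.map_poly_radical[OF j\<sigma>] poly_radical
          by (simp add: z power_mult_distrib R.\<theta>_power R.hom_mult R.hom_power)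
        from R.extend_hom[OF j\<sigma> this]
        obtain \<tau> where "field_hom \<tau>" "\<And>b. \<tau> (j b) = j (\<sigma> b)"
          unfolding o_apply by (elim exE conjE) blast
        then have "j (\<sigma> a) = j a" using fixed[of \<tau>] a fix_base by simp
        then show ?thesis by simp
      qed
      then have "a \<in> range i" by (rule U.galois_fixed_field)
      then show "x \<in> range (j \<circ> i)" using a by auto
    qed
    moreover have "range (j \<circ> i) \<subseteq> {x. \<forall>\<sigma>\<in>carrier (galois_group (j \<circ> i)). \<sigma> x = x}"
      by (auto simp: galois_group_carrier)
    ultimately show "galois_extension (j \<circ> i)"
      unfolding galois_extension_def algebraic_extension_def field_embedding_iff
      using algebraic ji.field_hom_axioms by blast
  qed
qed

end
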